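(* Let $\alpha_{max}\ge 1$. Given an initially empty dynamic graph $G$ on $n$ vertices undergoing a sequence of edge insertions and deletions such that the arboricity of $G$ is at most $\alpha_{max}$ at all times, there exists an algorithm maintaining an acyclic orientation of $G$ in which every vertex has out-degree at most $2\alpha_{max}+1$, with amortized insertion cost $O(\alpha_{max}^2)$ and amortized deletion cost $O(\alpha_{max}^2\log n)$.
   Context: A dynamic graph has a fixed vertex set of $n$ vertices and an edge set that changes by single edge insertions and deletions. The arboricity of a graph is the minimum number of forests into which its edge set can be partitioned. An orientation is acyclic if it contains no directed cycle. *)

theory Defs
  imports Complex_Main "HOL-Library.Disjoint_Sets"
begin

section \<open>Graphs, arboricity, orientations\<close>

text \<open>A simple graph on the vertex set \<open>{..<n}\<close> is given by its set of edges, each a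
  two-element set of vertices.\<close>

type_synonym graph = "nat set set"

definition is_cycle :: "graph \<Rightarrow> nat list \<Rightarrow> bool" where
  "is_cycle E vs \<longleftrightarrow> 3 \<le> length vs \<and> distinct vs \<and>
     (\<forall>i < length vs. {vs ! i, vs ! (Suc i mod length vs)} \<in> E)"

definition forest :: "graph \<Rightarrow> bool" where
  "forest E \<longleftrightarrow> (\<nexists>vs. is_cycle E vs)"

definition arboricity :: "graph \<Rightarrow> nat" where
  "arboricity E =
     (LEAST k. \<exists>P. partition_on E P \<and> finite P \<and> card P = k \<and> (\<forall>F \<in> P. forest F))"

definition orientation :: "graph \<Rightarrow> (nat \<times> nat) set \<Rightarrow> bool" where
  "orientation E D \<longleftrightarrow>
     (\<forall>u v. (u, v) \<in> D \<longrightarrow> {u, v} \<in> E) \<and>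
     (\<forall>u v. {u, v} \<in> E \<longrightarrow> ((u, v) \<in> D \<longleftrightarrow> (v, u) \<notin> D))"

definition outdegree :: "(nat \<times> nat) set \<Rightarrow> nat \<Rightarrow> nat" where
  "outdegree D u = card (D `` {u})"

section \<open>Dynamic graphs\<close>

datatype update = Insert nat nat | Delete nat nat

fun apply_update :: "update \<Rightarrow> graph \<Rightarrow> graph" where
  "apply_update (Insert u v) E = insert {u, v} E"
| "apply_update (Delete u v) E = E - {{u, v}}"

fun legal_update :: "nat \<Rightarrow> graph \<Rightarrow> update \<Rightarrow> bool" where
  "legal_update n E (Insert u v) \<longleftrightarrow> u < n \<and> v < n \<and> u \<noteq> v \<and> {u, v} \<notin> E"
| "legal_update n E (Delete u v) \<longleftrightarrow> {u, v} \<in> E"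

definition graph_after :: "update list \<Rightarrow> graph" where
  "graph_after us = fold apply_update us {}"

definition legal_sequence :: "nat \<Rightarrow> update list \<Rightarrow> bool" where
  "legal_sequence n us \<longleftrightarrow> (\<forall>i < length us. legal_update n (graph_after (take i us)) (us ! i))"

definition arboricity_bounded :: "nat \<Rightarrow> update list \<Rightarrow> bool" where
  "arboricity_bounded a us \<longleftrightarrow> (\<forall>i \<le> length us. arboricity (graph_after (take i us)) \<le> a)"

fun is_insertion :: "update \<Rightarrow> bool" where
  "is_insertion (Insert u v) \<longleftrightarrow> True"
| "is_insertion (Delete u v) \<longleftrightarrow> False"

definition insertions :: "update list \<Rightarrow> nat" where
  "insertions us = length (filter is_insertion us)"

definition deletions :: "update list \<Rightarrow> nat" where
  "deletions us = length (filter (\<lambda>x. \<not> is_insertion x) us)"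

section \<open>A word RAM\<close>

text \<open>
  The machine has registers and a random-access heap. Every cell holds a word of \<open>w\<close> bits,
  arithmetic is modulo \<open>2 ^ w\<close>, and every elementary operation (constant, register access,
  heap access, arithmetic operation, comparison, assignment, branch) costs one time unit.
  The usual convention of words of logarithmic size is a hypothesis of the form
  \<open>(n + a + 2) ^ c \<le> 2 ^ w\<close>, that is, \<open>w \<ge> c * log 2 (n + a + 2)\<close> for a constant \<open>c\<close>.
\<close>

datatype operator = Plus | Minus | Times | Divide | Less | Equal

datatype expr = Const nat | Reg nat | Heap expr | Op operator expr expr

datatype com =
    Skip
  | Assign nat expr
  | Store expr expr
  | Seq com com
  | Cond expr com com
  | While expr com

type_synonym memory = "nat \<Rightarrow> nat"
type_synonym state = "memory \<times> memory" \<comment> \<open>registers and heap\<close>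

fun op_value :: "nat \<Rightarrow> operator \<Rightarrow> nat \<Rightarrow> nat \<Rightarrow> nat" where
  "op_value w Plus a b = (a + b) mod 2 ^ w"
| "op_value w Minus a b = (2 ^ w + a - b) mod 2 ^ w"
| "op_value w Times a b = (a * b) mod 2 ^ w"
| "op_value w Divide a b = a div b"
| "op_value w Less a b = (if a < b then 1 else 0)"
| "op_value w Equal a b = (if a = b then 1 else 0)"

fun expr_value :: "nat \<Rightarrow> state \<Rightarrow> expr \<Rightarrow> nat" where
  "expr_value w s (Const k) = k mod 2 ^ w"
| "expr_value w s (Reg r) = fst s r"
| "expr_value w s (Heap e) = snd s (expr_value w s e)"
| "expr_value w s (Op f e1 e2) = op_value w f (expr_value w s e1) (expr_value w s e2)"

fun expr_time :: "expr \<Rightarrow> nat" where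
  "expr_time (Const k) = 1"
| "expr_time (Reg r) = 1"
| "expr_time (Heap e) = 1 + expr_time e"
| "expr_time (Op f e1 e2) = 1 + expr_time e1 + expr_time e2"

text \<open>\<open>exec w c s t s'\<close>: on words of \<open>w\<close> bits, \<open>c\<close> started in \<open>s\<close> terminates in \<open>s'\<close>
  after exactly \<open>t\<close> time units.\<close>

inductive exec :: "nat \<Rightarrow> com \<Rightarrow> state \<Rightarrow> nat \<Rightarrow> state \<Rightarrow> bool" for w where
  Skip: "exec w Skip s 1 s"
| Assign: "exec w (Assign r e) (R, H) (1 + expr_time e) (R(r := expr_value w (R, H) e), H)"
| Store: "exec w (Store e1 e2) (R, H) (1 + expr_time e1 + expr_time e2)
            (R, H(expr_value w (R, H) e1 := expr_value w (R, H) e2))"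
| Seq: "exec w c1 s t1 s' \<Longrightarrow> exec w c2 s' t2 s'' \<Longrightarrow> exec w (Seq c1 c2) s (t1 + t2) s''"
| CondTrue: "expr_value w s e \<noteq> 0 \<Longrightarrow> exec w c1 s t s' \<Longrightarrow>
     exec w (Cond e c1 c2) s (1 + expr_time e + t) s'"
| CondFalse: "expr_value w s e = 0 \<Longrightarrow> exec w c2 s t s' \<Longrightarrow>
     exec w (Cond e c1 c2) s (1 + expr_time e + t) s'"
| WhileFalse: "expr_value w s e = 0 \<Longrightarrow> exec w (While e c) s (1 + expr_time e) s"
| WhileTrue: "expr_value w s e \<noteq> 0 \<Longrightarrow> exec w c s t1 s' \<Longrightarrow> exec w (While e c) s' t2 s'' \<Longrightarrow>
     exec w (While e c) s (1 + expr_time e + t1 + t2) s''"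

section \<open>Dynamic graph algorithms on the word RAM\<close>

text \<open>
  A dynamic algorithm is a pair of programs, one run on each insertion and one on each deletion.
  A run starts with \<open>n\<close>, the arboricity bound \<open>a\<close> and the endpoints of the updated edge in
  registers 0 to 3 and with 0 in the other registers. Only the heap, which is initially all
  zero, persists between updates.
\<close>

record algorithm =
  insert_code :: com
  delete_code :: com

definition initial_registers :: "nat \<Rightarrow> nat \<Rightarrow> nat \<Rightarrow> nat \<Rightarrow> memory" where
  "initial_registers n a u v = (\<lambda>_. 0)(0 := n, 1 := a, 2 := u, 3 := v)"

fun process :: "algorithm \<Rightarrow> nat \<Rightarrow> nat \<Rightarrow> nat \<Rightarrow> update \<Rightarrow> memory \<Rightarrow> nat \<Rightarrow> memory \<Rightarrow> bool" where
  "process A w n a (Insert u v) H t H' \<longleftrightarrow>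
     (\<exists>R'. exec w (insert_code A) (initial_registers n a u v, H) t (R', H'))"
| "process A w n a (Delete u v) H t H' \<longleftrightarrow>
     (\<exists>R'. exec w (delete_code A) (initial_registers n a u v, H) t (R', H'))"

text \<open>\<open>run A w n a us t H\<close>: starting from the empty graph, \<open>A\<close> processes the updates \<open>us\<close> one
  after the other in total time \<open>t\<close>, leaving the heap \<open>H\<close>.\<close>

inductive run :: "algorithm \<Rightarrow> nat \<Rightarrow> nat \<Rightarrow> nat \<Rightarrow> update list \<Rightarrow> nat \<Rightarrow> memory \<Rightarrow> bool"
  for A w n a where
  start: "run A w n a [] 0 (\<lambda>_. 0)"
| step: "run A w n a us t H \<Longrightarrow> process A w n a x H t' H' \<Longrightarrow>
     run A w n a (us @ [x]) (t + t') H'"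

text \<open>
  The orientation is kept explicitly in the heap, as an array of out-neighbours for each vertex:
  the first \<open>n * (n + 1)\<close> cells form \<open>n\<close> rows of \<open>n + 1\<close> cells, and row \<open>u\<close> holds the number of
  out-neighbours of \<open>u\<close> followed by these out-neighbours without repetition. The remaining
  cells are working storage.
\<close>

definition out_list :: "nat \<Rightarrow> memory \<Rightarrow> nat \<Rightarrow> nat list" where
  "out_list n H u = map (\<lambda>i. H (u * (n + 1) + 1 + i)) [0..<H (u * (n + 1))]"

definition stores_digraph :: "nat \<Rightarrow> memory \<Rightarrow> (nat \<times> nat) set \<Rightarrow> bool" where
  "stores_digraph n H D \<longleftrightarrow>
     (\<forall>u < n. distinct (out_list n H u) \<and> set (out_list n H u) = D `` {u})"

text \<open>Correctness after every update of a sequence is expressed by demanding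
  \<open>maintains_orientation\<close> for the sequence and all its prefixes.\<close>

definition maintains_orientation ::
    "algorithm \<Rightarrow> nat \<Rightarrow> nat \<Rightarrow> nat \<Rightarrow> nat \<Rightarrow> update list \<Rightarrow> bool" where
  "maintains_orientation A w n a d us \<longleftrightarrow>
     (\<forall>i \<le> length us. \<exists>t H D. run A w n a (take i us) t H \<and> stores_digraph n H D \<and>
        orientation (graph_after (take i us)) D \<and> acyclic D \<and> (\<forall>v < n. outdegree D v \<le> d))"

text \<open>Amortized costs \<open>x\<close> per insertion and \<open>y\<close> per deletion: after every prefix, the total
  time is at most the sum of these charges. As \<open>exec\<close> is deterministic, the run is unique.\<close>

definition amortized_cost ::
    "algorithm \<Rightarrow> nat \<Rightarrow> nat \<Rightarrow> nat \<Rightarrow> real \<Rightarrow> real \<Rightarrow> update list \<Rightarrow> bool" where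
  "amortized_cost A w n a x y us \<longleftrightarrow>
     (\<forall>i \<le> length us. \<exists>t H. run A w n a (take i us) t H \<and>
        real t \<le> x * real (insertions (take i us)) + y * real (deletions (take i us)))"

end

theory Submission
  imports Defs
begin

text \<open>
  To insert \<open>uv\<close>, first reset \<open>v\<close>, that is, reverse all its out-edges; \<open>v\<close> is then a sink and
  \<open>u \<rightarrow> v\<close> closes no cycle. Afterwards reset vertices of out-degree above \<open>2\<alpha> + 1\<close> as long as
  there are any. Resets preserve acyclicity because they produce sinks, and they need out-lists only.

  The number of resets is bounded as by Brodal and Fagerberg, but against a half-integral reference
  orientation: every edge is split into two half-edges, and every vertex has at most \<open>2\<alpha> + 1\<close>
  outgoing half-edges. The potential is the number of half-edges on which the maintained orientation
  disagrees with the reference. A reset at out-degree \<open>d\<close> lowers it by at least \<open>2(d - (2\<alpha> + 1))\<close>,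
  and the reset that precedes an insertion raises it by \<open>O(\<alpha>)\<close>. The reference is constructed
  backwards in time. Undoing an insertion is free; undoing a deletion inserts an edge, for which two
  half-edges are rerouted along shortest paths. The doubled graph has at most \<open>2\<alpha>|S|\<close> edges inside
  a vertex set \<open>S\<close>, so the layers of a breadth-first search grow by the factor \<open>1 + 1/(2\<alpha>)\<close>
  and the paths have length \<open>O(\<alpha> log n)\<close>.
\<close>

section \<open>Arboricity bounds the density\<close>

definition simple_graph :: "nat \<Rightarrow> graph \<Rightarrow> bool" where
  "simple_graph n E \<longleftrightarrow> (\<forall>e \<in> E. \<exists>u v. e = {u, v} \<and> u \<noteq> v \<and> u < n \<and> v < n)"

text \<open>The weak Nash-Williams density condition. It passes to subgraphs by mere counting, and
  density is all that the breadth-first search below consumes.\<close>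

definition sparse :: "nat \<Rightarrow> graph \<Rightarrow> bool" where
  "sparse a E \<longleftrightarrow> (\<forall>S. finite S \<longrightarrow> card {e \<in> E. e \<subseteq> S} \<le> a * card S)"

lemma simple_graph_finite: "simple_graph n E \<Longrightarrow> finite E"
  by (rule finite_subset[of _ "Pow {..<n}"]) (auto simp: simple_graph_def)

lemma simple_graph_edgeD: "simple_graph n E \<Longrightarrow> {u, v} \<in> E \<Longrightarrow> u \<noteq> v \<and> u < n \<and> v < n"
  unfolding simple_graph_def by (metis doubleton_eq_iff)

text \<open>A longest path is closed to a cycle: all neighbours of its first vertex in
  \<open>S\<close> lie on it, since otherwise it could be extended, and one of them is not the
  second vertex.\<close>

lemma cycle_if_min_degree_2:
  fixes S :: "nat set"
  assumes "finite S" "S \<noteq> {}"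
    and deg: "\<And>v. v \<in> S \<Longrightarrow>
      \<exists>y \<in> S. \<exists>z \<in> S. y \<noteq> z \<and> y \<noteq> v \<and> z \<noteq> v \<and> {v, y} \<in> F \<and> {v, z} \<in> F"
  shows "\<exists>vs. is_cycle F vs"
proof -
  define path where "path ps \<longleftrightarrow> distinct ps \<and> set ps \<subseteq> S \<and> ps \<noteq> [] \<and>
      (\<forall>i. Suc i < length ps \<longrightarrow> {ps ! i, ps ! Suc i} \<in> F)" for ps
  obtain s where "s \<in> S" using assms(2) by auto
  hence "path [s]" by (auto simp: path_def)
  moreover have "\<forall>ps. path ps \<longrightarrow> length ps < Suc (card S)"
  proof (intro allI impI)
    fix ps assume "path ps"
    hence "card (set ps) = length ps" "set ps \<subseteq> S" by (simp_all add: path_def distinct_card)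
    thus "length ps < Suc (card S)" by (metis card_mono[OF assms(1)] less_Suc_eq_le)
  qed
  ultimately have "\<exists>ps. path ps \<and> (\<forall>qs. path qs \<longrightarrow> length qs \<le> length ps)"
    by (rule ex_has_greatest_nat[where f = length])
  then obtain ps where ps: "path ps" and longest: "\<And>qs. path qs \<Longrightarrow> length qs \<le> length ps"
    by metis
  define v where "v = ps ! 0"
  have "v \<in> S" using ps by (auto simp: path_def v_def)
  \<comment> \<open>For a one-vertex path \<open>ps ! 1\<close> is an unspecified value; of two
    distinct neighbours one still differs from it.\<close>
  then obtain y where y: "y \<in> S" "y \<noteq> v" "{v, y} \<in> F" "y \<noteq> ps ! 1" using deg by metis
  have "y \<in> set ps"
  proof (rule ccontr)
    assume "y \<notin> set ps"
    hence "path (y # ps)"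
      using ps y by (auto simp: path_def v_def nth_Cons insert_commute[of y] split: nat.split)
    from longest[OF this] show False by simp
  qed
  then obtain j where j: "j < length ps" "y = ps ! j" by (metis in_set_conv_nth)
  have "j \<noteq> 0" "j \<noteq> 1" using y j v_def by metis+
  hence j2: "j \<ge> 2" by linarith
  \<comment> \<open>The initial segment up to \<open>y\<close> is closed by the edge from
    \<open>y\<close> back to \<open>v\<close>; \<open>j >= 2\<close> gives the three vertices that
    \<open>is_cycle\<close> asks for.\<close>
  have "is_cycle F (take (Suc j) ps)"
    unfolding is_cycle_def
  proof (intro conjI allI impI)
    show "3 \<le> length (take (Suc j) ps)" using j j2 by simp
    show "distinct (take (Suc j) ps)" using ps by (simp add: path_def)
    fix i assume "i < length (take (Suc j) ps)"
    hence i: "i \<le> j" by simp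
    show "{take (Suc j) ps ! i, take (Suc j) ps ! (Suc i mod length (take (Suc j) ps))} \<in> F"
    proof (cases "i = j")
      case True
      thus ?thesis using j y by (simp add: insert_commute v_def min_absorb2)
    next
      case False
      thus ?thesis using i j ps by (simp add: path_def min_absorb2)
    qed
  qed
  thus ?thesis by blast
qed

text \<open>Leaf removal: by \<open>cycle_if_min_degree_2\<close> some vertex of a nonempty
  \<open>S\<close> has at most one edge inside \<open>S\<close>, and deleting it loses one vertex
  and at most one edge.\<close>

lemma forest_sparse:
  assumes "forest F" "simple_graph n F" "finite S"
  shows "card {e \<in> F. e \<subseteq> S} \<le> card S"
  using assms(3)
proof (induction S rule: finite_psubset_induct)
  case (psubset S)
  show ?case
  proof (cases "S = {}")
    case True
    have "{e \<in> F. e \<subseteq> {}} = {}" using assms(2) by (auto simp: simple_graph_def)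
    thus ?thesis using True by simp
  next
    case False
    have "\<exists>v\<in>S. \<not> (\<exists>y \<in> S. \<exists>z \<in> S. y \<noteq> z \<and> y \<noteq> v \<and> z \<noteq> v \<and> {v, y} \<in> F \<and> {v, z} \<in> F)"
      using cycle_if_min_degree_2[OF psubset.hyps False, of F] assms(1)
      unfolding forest_def by blast
    then obtain v where v: "v \<in> S"
      and leaf: "\<not> (\<exists>y \<in> S. \<exists>z \<in> S. y \<noteq> z \<and> y \<noteq> v \<and> z \<noteq> v \<and> {v, y} \<in> F \<and> {v, z} \<in> F)"
      by blast
    let ?N = "{e \<in> F. e \<subseteq> S \<and> v \<in> e}"
    have fin: "finite ?N" using simple_graph_finite[OF assms(2)] by simp
    have shape: "\<exists>y \<in> S. y \<noteq> v \<and> e = {v, y} \<and> {v, y} \<in> F" if "e \<in> ?N" for e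
    proof -
      have e: "e \<in> F" "e \<subseteq> S" "v \<in> e" using that by auto
      obtain p q where pq: "e = {p, q}" "p \<noteq> q"
        using assms(2) e(1) unfolding simple_graph_def by metis
      show ?thesis
      proof (cases "v = p")
        case True
        thus ?thesis using e pq by (intro bexI[of _ q]) auto
      next
        case False
        hence "e = {v, p}" using e pq by auto
        thus ?thesis using e pq False by (intro bexI[of _ p]) auto
      qed
    qed
    have "e = e'" if e: "e \<in> ?N" and e': "e' \<in> ?N" for e e'
    proof -
      obtain y where y: "y \<in> S" "y \<noteq> v" "e = {v, y}" "{v, y} \<in> F" using shape[OF e] by metis
      obtain z where z: "z \<in> S" "z \<noteq> v" "e' = {v, z}" "{v, z} \<in> F"
        using shape[OF e'] by metis
      have "y = z" using leaf y(1,2,4) z(1,2,4) by metis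
      thus ?thesis using y(3) z(3) by simp
    qed
    hence "card ?N \<le> 1" unfolding One_nat_def card_le_Suc0_iff_eq[OF fin] by blast
    moreover have "card {e \<in> F. e \<subseteq> S - {v}} \<le> card (S - {v})"
      using v by (intro psubset.IH) auto
    moreover have "card {e \<in> F. e \<subseteq> S} \<le> card ?N + card {e \<in> F. e \<subseteq> S - {v}}"
    proof -
      have "{e \<in> F. e \<subseteq> S} = ?N \<union> {e \<in> F. e \<subseteq> S - {v}}" by blast
      thus ?thesis using card_Un_le[of ?N "{e \<in> F. e \<subseteq> S - {v}}"] by (simp only:)
    qed
    moreover have "Suc (card (S - {v})) = card S" by (rule card_Suc_Diff1[OF psubset.hyps v])
    ultimately show ?thesis by linarith
  qed
qed

text \<open>\<open>LEAST\<close> is meaningful only if some admissible partition exists; the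
  partition into single edges is one.\<close>

lemma partition_into_forests:
  assumes "simple_graph n E"
  obtains P where "partition_on E P" "finite P" "card P = arboricity E" "\<forall>F \<in> P. forest F"
proof -
  define Q where "Q k \<longleftrightarrow> (\<exists>P. partition_on E P \<and> finite P \<and> card P = k \<and> (\<forall>F \<in> P. forest F))" for k
  let ?P = "(\<lambda>e. {e}) ` E"
  have singleton: "forest {e}" if "e \<in> E" for e
    unfolding forest_def is_cycle_def
  proof
    assume "\<exists>vs. 3 \<le> length vs \<and> distinct vs \<and>
        (\<forall>i<length vs. {vs ! i, vs ! (Suc i mod length vs)} \<in> {e})"
    then obtain vs where vs: "3 \<le> length vs" "distinct vs"
        "\<And>i. i < length vs \<Longrightarrow> {vs ! i, vs ! (Suc i mod length vs)} = e" by blast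
    \<comment> \<open>If the first two edges of the cycle were the same edge, \<open>vs ! 0\<close>
      and \<open>vs ! 2\<close> would coincide.\<close>
    have "Suc 0 mod length vs = 1" "Suc 1 mod length vs = 2" using vs(1) by simp_all
    moreover have "0 < length vs" "1 < length vs" using vs(1) by linarith+
    ultimately have "{vs ! 0, vs ! 1} = {vs ! 1, vs ! 2}" using vs(3)[of 0] vs(3)[of 1] by metis
    hence "vs ! 0 = vs ! 2" by (auto simp: doubleton_eq_iff)
    moreover have "2 < length vs" using vs(1) by linarith
    ultimately show False using nth_eq_iff_index_eq[OF vs(2), of 0 2] by force
  qed
  have "partition_on E ?P" by (auto simp: partition_on_def disjoint_def)
  moreover have "finite ?P" using simple_graph_finite[OF assms] by simp
  ultimately have "Q (card ?P)" unfolding Q_def using singleton by (intro exI[of _ ?P]) auto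
  hence "Q (LEAST k. Q k)" by (rule LeastI)
  moreover have "(LEAST k. Q k) = arboricity E" unfolding arboricity_def Q_def ..
  ultimately show ?thesis using that unfolding Q_def by auto
qed

text \<open>Easy half of the Nash-Williams theorem: each of the at most \<open>a\<close> forests
  contributes at most \<open>card S\<close> edges.\<close>

lemma sparse_if_arboricity_le:
  assumes "simple_graph n E" "arboricity E \<le> a"
  shows "sparse a E"
  unfolding sparse_def
proof (intro allI impI)
  fix S :: "nat set" assume S: "finite S"
  obtain P where P: "partition_on E P" "finite P" "card P = arboricity E" "\<forall>F \<in> P. forest F"
    using partition_into_forests[OF assms(1)] .
  have E: "E = \<Union>P" using P(1) by (simp add: partition_on_def)
  hence "F \<subseteq> E" if "F \<in> P" for F using that by blast
  hence simple: "simple_graph n F" if "F \<in> P" for F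
    using assms(1) that unfolding simple_graph_def by blast
  have "{e \<in> E. e \<subseteq> S} = (\<Union>F \<in> P. {e \<in> F. e \<subseteq> S})"
    unfolding E by blast
  hence "card {e \<in> E. e \<subseteq> S} \<le> (\<Sum>F \<in> P. card {e \<in> F. e \<subseteq> S})"
    using card_UN_le[OF P(2), of "\<lambda>F. {e \<in> F. e \<subseteq> S}"] by (simp only:)
  also have "\<dots> \<le> (\<Sum>F \<in> P. card S)"
    using P(4) simple S by (intro sum_mono forest_sparse) auto
  also have "\<dots> \<le> a * card S" using P(3) assms(2) by simp
  finally show "card {e \<in> E. e \<subseteq> S} \<le> a * card S" .
qed

lemma sparse_mono:
  assumes "sparse a E" "E' \<subseteq> E" "finite E"
  shows "sparse a E'"
  unfolding sparse_def
proof (intro allI impI)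
  fix S :: "nat set" assume "finite S"
  have "card {e \<in> E'. e \<subseteq> S} \<le> card {e \<in> E. e \<subseteq> S}"
    using assms by (intro card_mono) auto
  also have "\<dots> \<le> a * card S" using assms(1) \<open>finite S\<close> by (simp add: sparse_def)
  finally show "card {e \<in> E'. e \<subseteq> S} \<le> a * card S" .
qed

section \<open>Half-integral orientations\<close>

type_synonym weights = "nat \<times> nat \<Rightarrow> nat"

definition out_weight :: "nat \<Rightarrow> weights \<Rightarrow> nat \<Rightarrow> nat" where
  "out_weight n x u = (\<Sum>v<n. x (u, v))"

text \<open>Weights are doubled so as to stay in the natural numbers: every edge carries total weight 2.\<close>

definition half_orientation :: "nat \<Rightarrow> nat \<Rightarrow> graph \<Rightarrow> weights \<Rightarrow> bool" where
  "half_orientation n k E x \<longleftrightarrow>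
     (\<forall>u v. x (u, v) + x (v, u) = (if {u, v} \<in> E then 2 else 0)) \<and>
     (\<forall>u<n. out_weight n x u \<le> k)"

lemma out_weight_upd:
  assumes "v < n"
  shows "out_weight n (x((u, v) := c)) u + x (u, v) = out_weight n x u + c"
proof -
  have "out_weight n y u = y (u, v) + (\<Sum>z\<in>{..<n} - {v}. y (u, z))" for y
    unfolding out_weight_def using assms by (intro sum.remove) auto
  note * = this[of x] this[of "x((u, v) := c)"]
  have "(\<Sum>z\<in>{..<n} - {v}. (x((u, v) := c)) (u, z)) = (\<Sum>z\<in>{..<n} - {v}. x (u, z))"
    by (intro sum.cong) auto
  thus ?thesis using * by simp
qed

lemma out_weight_upd_other: "u \<noteq> u' \<Longrightarrow> out_weight n (x((u, v) := c)) u' = out_weight n x u'"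
  unfolding out_weight_def by (intro sum.cong) auto

lemma sum_shift_le:
  fixes x x' :: "'a \<Rightarrow> nat"
  assumes "finite F" "\<And>e. x e \<le> x' e + of_bool (e = d)"
  shows "sum x F \<le> sum x' F + 1"
proof -
  have "sum x F \<le> (\<Sum>e\<in>F. x' e + of_bool (e = d))" using assms(2) by (intro sum_mono)
  also have "\<dots> = sum x' F + (\<Sum>e\<in>F. of_bool (e = d))" by (rule sum.distrib)
  also have "(\<Sum>e\<in>F. of_bool (e = d)) \<le> (1::nat)" using assms(1) by (simp add: of_bool_def)
  finally show ?thesis by simp
qed

text \<open>The excess unit at the head of the path is pushed along the path, one edge at a time.\<close>

lemma reroute_along_path:
  assumes "distinct ps" "ps \<noteq> []" "set ps \<subseteq> {..<n}" "successively (\<lambda>u v. 0 < x (u, v)) ps"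
    and "\<And>u. u < n \<Longrightarrow> out_weight n x u + of_bool (u = last ps) \<le> k + of_bool (u = hd ps)"
  shows "\<exists>x'. (\<forall>u v. x' (u, v) + x' (v, u) = x (u, v) + x (v, u)) \<and>
    (\<forall>u<n. out_weight n x' u \<le> k) \<and> (\<forall>F. finite F \<longrightarrow> sum x F \<le> sum x' F + length ps)"
  using assms
proof (induction ps arbitrary: x)
  case Nil
  thus ?case by simp
next
  case (Cons r qs)
  show ?case
  proof (cases qs)
    case Nil
    thus ?thesis using Cons.prems by (intro exI[of _ x]) auto
  next
    case (Cons p rs)
    note prems = Cons.prems
    have rp: "r \<noteq> p" "r < n" "p < n" "0 < x (r, p)" "r \<notin> set qs"
      using prems Cons by auto
    define x1 where "x1 = x((r, p) := x (r, p) - 1)"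
    define x2 where "x2 = x1((p, r) := x (p, r) + 1)"
    have w1: "out_weight n x1 r + 1 = out_weight n x r"
      using out_weight_upd[OF rp(3), of x r "x (r, p) - 1"] rp(4) by (simp add: x1_def)
    have w2: "out_weight n x2 p = out_weight n x1 p + 1"
      using out_weight_upd[OF rp(2), of x1 p "x (p, r) + 1"] rp(1) by (simp add: x2_def x1_def)
    \<comment> \<open>The shift moves the excess unit from \<open>r\<close> to \<open>p\<close>, the
      head of the remaining path, as the induction hypothesis expects.\<close>
    have w: "out_weight n x2 u + of_bool (u = r) = out_weight n x u + of_bool (u = p)" for u
      using w1 w2 rp(1) by (auto simp: x2_def x1_def out_weight_upd_other)
    have "\<exists>x'. (\<forall>u v. x' (u, v) + x' (v, u) = x2 (u, v) + x2 (v, u)) \<and>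
      (\<forall>u<n. out_weight n x' u \<le> k) \<and> (\<forall>F. finite F \<longrightarrow> sum x2 F \<le> sum x' F + length qs)"
    proof (rule Cons.IH)
      show "distinct qs" "qs \<noteq> []" "set qs \<subseteq> {..<n}" using prems Cons by auto
      have "successively (\<lambda>u v. 0 < x (u, v)) qs" using prems(4) Cons by simp
      \<comment> \<open>Only the weight of \<open>(r, p)\<close> decreases, and \<open>r\<close>
        does not occur in \<open>qs\<close>.\<close>
      thus "successively (\<lambda>u v. 0 < x2 (u, v)) qs"
        by (rule successively_mono) (use rp in \<open>auto simp: x2_def x1_def\<close>)
      fix u assume "u < n"
      from prems(5)[OF this] w[of u]
      show "out_weight n x2 u + of_bool (u = last qs) \<le> k + of_bool (u = hd qs)"
        using Cons by simp
    qed
    then obtain x' where x': "\<And>u v. x' (u, v) + x' (v, u) = x2 (u, v) + x2 (v, u)"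
        "\<And>u. u < n \<Longrightarrow> out_weight n x' u \<le> k"
        "\<And>F. finite F \<Longrightarrow> sum x2 F \<le> sum x' F + length qs" by blast
    have "x2 (u, v) + x2 (v, u) = x (u, v) + x (v, u)" for u v
      using rp by (auto simp: x2_def x1_def)
    \<comment> \<open>A shift lowers the weight of one ordered pair only, so over any
      \<open>F\<close> the sum drops by at most 1 per shift.\<close>
    moreover have "sum x F \<le> sum x' F + length (r # qs)" if "finite F" for F
    proof -
      have "sum x F \<le> sum x2 F + 1"
        using that by (rule sum_shift_le[where d = "(r, p)"]) (use rp in \<open>auto simp: x2_def x1_def\<close>)
      with x'(3)[OF that] show ?thesis by simp
    qed
    ultimately show ?thesis using x' by (intro exI[of _ x']) auto
  qed
qed

section \<open>Breadth-first search along positive weights\<close>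

fun layer :: "nat \<Rightarrow> weights \<Rightarrow> nat \<Rightarrow> nat \<Rightarrow> nat set" where
  "layer n x r 0 = {r}"
| "layer n x r (Suc i) = layer n x r i \<union> {v. v < n \<and> (\<exists>u \<in> layer n x r i. 0 < x (u, v))}"

lemma layer_subset: "r < n \<Longrightarrow> layer n x r i \<subseteq> {..<n}"
  by (induction i) auto

text \<open>\<open>reroute_along_path\<close> requires a simple path, so if \<open>v\<close> already
  occurs on the path to its predecessor, that path is cut at \<open>v\<close>.\<close>

lemma path_to_layer:
  assumes "r < n" "v \<in> layer n x r i"
  shows "\<exists>ps. distinct ps \<and> ps \<noteq> [] \<and> set ps \<subseteq> {..<n} \<and> successively (\<lambda>u v. 0 < x (u, v)) ps \<and>
    hd ps = r \<and> last ps = v \<and> length ps \<le> Suc i"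
  using assms(2)
proof (induction i arbitrary: v)
  case 0
  thus ?case using assms(1) by (intro exI[of _ "[r]"]) auto
next
  case (Suc i)
  show ?case
  proof (cases "v \<in> layer n x r i")
    case True
    with Suc.IH show ?thesis by (meson le_SucI)
  next
    case False
    then obtain u where u: "u \<in> layer n x r i" "0 < x (u, v)" "v < n" using Suc.prems by auto
    from Suc.IH[OF u(1)] obtain ps where ps: "distinct ps" "ps \<noteq> []" "set ps \<subseteq> {..<n}"
      "successively (\<lambda>u v. 0 < x (u, v)) ps" "hd ps = r" "last ps = u" "length ps \<le> Suc i" by blast
    show ?thesis
    proof (cases "v \<in> set ps")
      case True
      then obtain as bs where split: "ps = as @ v # bs" by (meson split_list)
      have "hd (as @ [v]) = r" using ps(5) split by (cases as) auto
      moreover have "successively (\<lambda>u v. 0 < x (u, v)) (as @ [v])"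
        using ps(4) unfolding split by (auto simp: successively_append_iff)
      ultimately show ?thesis using ps split by (intro exI[of _ "as @ [v]"]) auto
    next
      case False
      thus ?thesis using ps u
        by (intro exI[of _ "ps @ [v]"]) (auto simp: successively_append_iff)
    qed
  qed
qed

text \<open>Ordered pairs are grouped by their underlying edge; each group weighs at most 2, and
  pairs that are no edges weigh 0.\<close>

lemma sum_weights_le_edges:
  assumes "simple_graph n E" "finite S"
    and "\<And>u v. x (u, v) + x (v, u) \<le> (if {u, v} \<in> E then 2 else 0)"
  shows "sum x (S \<times> S) \<le> 2 * card {e \<in> E. e \<subseteq> S}"
proof -
  let ?T = "{e \<in> E. e \<subseteq> S}"
  let ?P = "{p \<in> S \<times> S. {fst p, snd p} \<in> E}"
  have "x p = 0" if "p \<in> S \<times> S - ?P" for p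
    using that assms(3)[of "fst p" "snd p"] by (auto split: if_splits)
  hence "sum x (S \<times> S) = sum x ?P" using assms(2) by (intro sum.mono_neutral_right) auto
  also have "\<dots> = (\<Sum>e \<in> ?T. sum x {p \<in> ?P. {fst p, snd p} = e})"
    using assms(2) simple_graph_finite[OF assms(1)] by (intro sum.group[symmetric]) auto
  also have "\<dots> \<le> (\<Sum>e \<in> ?T. 2)"
  proof (rule sum_mono)
    fix e assume "e \<in> ?T"
    then obtain u v where e: "e = {u, v}" "u \<noteq> v" "e \<in> E"
      using assms(1) by (auto simp: simple_graph_def)
    have "sum x {p \<in> ?P. {fst p, snd p} = e} \<le> sum x {(u, v), (v, u)}"
      by (rule sum_mono2) (auto simp: e doubleton_eq_iff)
    also have "\<dots> = x (u, v) + x (v, u)" using e(2) by simp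
    also have "\<dots> \<le> 2" using assms(3)[of u v] by (auto split: if_splits)
    finally show "sum x {p \<in> ?P. {fst p, snd p} = e} \<le> 2" .
  qed
  also have "\<dots> = 2 * card ?T" by simp
  finally show ?thesis .
qed

text \<open>\<open>layer\<close> is cumulative, a ball rather than a sphere. All out-weight of a
  ball stays in the next ball, where sparsity bounds it by \<open>2 * a\<close> per vertex.
  Hypothesis \<open>tot\<close> is an inequality so that it also covers an edge carrying only one of
  its half-edges.\<close>

lemma layer_growth:
  assumes "simple_graph n E" "sparse a E" "r < n"
    and tot: "\<And>u v. x (u, v) + x (v, u) \<le> (if {u, v} \<in> E then 2 else 0)"
    and full: "\<And>u. u \<in> layer n x r i \<Longrightarrow> 2 * a + 1 \<le> out_weight n x u"
  shows "(2 * a + 1) * card (layer n x r i) \<le> 2 * a * card (layer n x r (Suc i))"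
proof -
  let ?V = "layer n x r i" and ?W = "layer n x r (Suc i)"
  have W: "?W \<subseteq> {..<n}" "finite ?W"
    using layer_subset[OF assms(3)] by (blast, meson finite_lessThan finite_subset)
  have "(2 * a + 1) * card ?V = (\<Sum>u \<in> ?V. 2 * a + 1)" by simp
  also have "\<dots> \<le> (\<Sum>u \<in> ?V. out_weight n x u)" using full by (intro sum_mono) auto
  also have "\<dots> = (\<Sum>u \<in> ?V. \<Sum>v \<in> ?W. x (u, v))"
    unfolding out_weight_def
  proof (rule sum.cong[OF refl])
    fix u assume u: "u \<in> ?V"
    show "(\<Sum>v<n. x (u, v)) = (\<Sum>v \<in> ?W. x (u, v))"
      by (rule sum.mono_neutral_right) (use u W in auto)
  qed
  also have "\<dots> \<le> (\<Sum>u \<in> ?W. \<Sum>v \<in> ?W. x (u, v))"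
    using W(2) by (intro sum_mono2) auto
  also have "\<dots> = sum x (?W \<times> ?W)" by (simp add: sum.cartesian_product)
  also have "\<dots> \<le> 2 * card {e \<in> E. e \<subseteq> ?W}"
    by (rule sum_weights_le_edges[OF assms(1) W(2) tot])
  also have "\<dots> \<le> 2 * (a * card ?W)" using assms(2) W(2) unfolding sparse_def by (meson mult_le_mono2)
  finally show ?thesis by simp
qed

text \<open>If all balls of radius below \<open>l\<close> were saturated, \<open>l\<close> growth
  steps by the factor \<open>(2 * a + 1) / (2 * a)\<close> from a single vertex would yield more
  than \<open>n\<close> vertices. Denominators are cleared to stay in the natural numbers.\<close>

lemma slack_within_distance:
  assumes "simple_graph n E" "sparse a E" "r < n"
    and tot: "\<And>u v. x (u, v) + x (v, u) \<le> (if {u, v} \<in> E then 2 else 0)"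
    and long: "n * (2 * a) ^ l < (2 * a + 1) ^ l"
  shows "\<exists>i<l. \<exists>z \<in> layer n x r i. out_weight n x z \<le> 2 * a"
proof (rule ccontr)
  assume "\<not> ?thesis"
  hence full: "2 * a + 1 \<le> out_weight n x u" if "i < l" "u \<in> layer n x r i" for i u
    using that by (metis Suc_eq_plus1 not_less_eq_eq)
  have "(2 * a + 1) ^ i \<le> (2 * a) ^ i * card (layer n x r i)" if "i \<le> l" for i
    using that
  proof (induction i)
    case (Suc i)
    have "(2 * a + 1) ^ Suc i \<le> (2 * a + 1) * ((2 * a) ^ i * card (layer n x r i))"
      using Suc by (simp del: mult_Suc)
    also have "\<dots> = (2 * a) ^ i * ((2 * a + 1) * card (layer n x r i))" by algebra
    also have "\<dots> \<le> (2 * a) ^ i * (2 * a * card (layer n x r (Suc i)))"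
      using Suc.prems by (intro mult_le_mono2 layer_growth[OF assms(1-4)] full) auto
    finally show ?case by (simp only: power_Suc2 mult.assoc)
  qed simp
  from this[of l] have "(2 * a + 1) ^ l \<le> (2 * a) ^ l * card (layer n x r l)" by simp
  also have "card (layer n x r l) \<le> n"
    using card_mono[OF finite_lessThan layer_subset[OF assms(3)], of x l] by simp
  finally show False using long by (simp add: mult.commute)
qed

text \<open>The new half-edge leaves \<open>r\<close> and may overload it by one unit. A vertex with
  slack lies at distance below \<open>l\<close>, and the unit is pushed there.\<close>

lemma add_half_edge:
  assumes "simple_graph n E" "sparse a E" "{r, z} \<in> E"
    and tot: "\<And>u v. x (u, v) + x (v, u) + of_bool ({u, v} = {r, z}) \<le> (if {u, v} \<in> E then 2 else 0)"
    and out: "\<And>u. u < n \<Longrightarrow> out_weight n x u \<le> 2 * a + 1"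
    and long: "n * (2 * a) ^ l < (2 * a + 1) ^ l"
  shows "\<exists>x'. (\<forall>u v. x' (u, v) + x' (v, u) = x (u, v) + x (v, u) + of_bool ({u, v} = {r, z})) \<and>
    (\<forall>u<n. out_weight n x' u \<le> 2 * a + 1) \<and> (\<forall>F. finite F \<longrightarrow> sum x F \<le> sum x' F + l)"
proof -
  have rz: "r \<noteq> z" "r < n" "z < n" using simple_graph_edgeD[OF assms(1,3)] by auto
  define y where "y = x((r, z) := x (r, z) + 1)"
  have y: "y (u, v) + y (v, u) = x (u, v) + x (v, u) + of_bool ({u, v} = {r, z})" for u v
    using rz by (auto simp: y_def doubleton_eq_iff)
  have w: "out_weight n y u = out_weight n x u + of_bool (u = r)" for u
    using out_weight_upd[OF rz(3), of x r "x (r, z) + 1"] out_weight_upd_other[of r u]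
    by (auto simp: y_def)
  obtain i q where q: "i < l" "q \<in> layer n y r i" "out_weight n y q \<le> 2 * a"
    using slack_within_distance[OF assms(1,2) rz(2) _ long, of y] tot unfolding y by blast
  from path_to_layer[OF rz(2) q(2)] obtain ps where ps: "distinct ps" "ps \<noteq> []"
    "set ps \<subseteq> {..<n}" "successively (\<lambda>u v. 0 < y (u, v)) ps" "hd ps = r" "last ps = q"
    "length ps \<le> Suc i" by blast
  \<comment> \<open>Only two vertices matter: \<open>r\<close> has at most one unit too many, and
    \<open>q\<close> has room for one. If they coincide, nothing has to be moved.\<close>
  have "out_weight n y u + of_bool (u = last ps) \<le> 2 * a + 1 + of_bool (u = hd ps)" if "u < n" for u
    using out[OF that] q(3) ps(5,6) w[of u] by auto
  from reroute_along_path[OF ps(1-4) this] obtain x' where x':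
    "\<And>u v. x' (u, v) + x' (v, u) = y (u, v) + y (v, u)"
    "\<And>u. u < n \<Longrightarrow> out_weight n x' u \<le> 2 * a + 1"
    "\<And>F. finite F \<Longrightarrow> sum y F \<le> sum x' F + length ps" by blast
  have "sum x F \<le> sum x' F + l" if "finite F" for F
  proof -
    have "sum x F \<le> sum y F" by (intro sum_mono) (auto simp: y_def)
    with x'(3)[OF that] ps(7) q(1) show ?thesis by linarith
  qed
  thus ?thesis using x' y by (intro exI[of _ x']) auto
qed

text \<open>The two half-edges are added one after the other, each at cost \<open>l\<close>. The set
  \<open>F\<close> stays arbitrary; later it is the converse of the maintained digraph.\<close>

lemma half_orientation_insert:
  assumes "simple_graph n (insert {r, z} E)" "sparse a (insert {r, z} E)" "{r, z} \<notin> E"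
    and x: "half_orientation n (2 * a + 1) E x"
    and long: "n * (2 * a) ^ l < (2 * a + 1) ^ l"
  shows "\<exists>x'. half_orientation n (2 * a + 1) (insert {r, z} E) x' \<and>
    (\<forall>F. finite F \<longrightarrow> sum x F \<le> sum x' F + 2 * l)"
proof -
  have xt: "x (u, v) + x (v, u) = (if {u, v} \<in> E then 2 else 0)" for u v
    using x by (auto simp: half_orientation_def)
  obtain x1 where x1:
    "\<And>u v. x1 (u, v) + x1 (v, u) = x (u, v) + x (v, u) + of_bool ({u, v} = {r, z})"
    "\<And>u. u < n \<Longrightarrow> out_weight n x1 u \<le> 2 * a + 1"
    "\<And>F. finite F \<Longrightarrow> sum x F \<le> sum x1 F + l"
    using add_half_edge[OF assms(1,2) _ _ _ long, of r z x] xt x assms(3)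
    by (force simp: half_orientation_def)
  obtain x2 where x2:
    "\<And>u v. x2 (u, v) + x2 (v, u) = x1 (u, v) + x1 (v, u) + of_bool ({u, v} = {r, z})"
    "\<And>u. u < n \<Longrightarrow> out_weight n x2 u \<le> 2 * a + 1"
    "\<And>F. finite F \<Longrightarrow> sum x1 F \<le> sum x2 F + l"
    using add_half_edge[OF assms(1,2) _ _ _ long, of r z x1] x1 xt assms(3)
    by (force simp: half_orientation_def)
  have "half_orientation n (2 * a + 1) (insert {r, z} E) x2"
    using x2 x1 xt assms(3) by (auto simp: half_orientation_def)
  moreover have "sum x F \<le> sum x2 F + 2 * l" if "finite F" for F
    using x1(3)[OF that] x2(3)[OF that] by linarith
  ultimately show ?thesis by blast
qed

text \<open>Supplies the reference for the final graph, where the backward construction starts. It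
  is built by inserting the edges one by one.\<close>

lemma half_orientation_exists:
  assumes "simple_graph n E" "sparse a E" and long: "n * (2 * a) ^ l < (2 * a + 1) ^ l"
  shows "\<exists>x. half_orientation n (2 * a + 1) E x"
  using simple_graph_finite[OF assms(1)] assms(1,2)
proof (induction E rule: finite_induct)
  case empty
  show ?case by (intro exI[of _ "\<lambda>_. 0"]) (auto simp: half_orientation_def out_weight_def)
next
  case (insert e E)
  have "simple_graph n E" using insert.prems(1) by (auto simp: simple_graph_def)
  moreover have "sparse a E"
    by (rule sparse_mono[OF insert.prems(2)]) (use insert.hyps(1) in auto)
  ultimately obtain x where "half_orientation n (2 * a + 1) E x" using insert.IH by blast
  moreover obtain r z where "e = {r, z}" using insert.prems(1) by (auto simp: simple_graph_def)
  ultimately show ?case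
    using half_orientation_insert[OF _ _ _ _ long] insert.prems insert.hyps(2) by blast
qed

text \<open>Dropping both half-edges of \<open>e\<close> disturbs no other weight; hence undoing an
  insertion is free.\<close>

lemma half_orientation_delete:
  assumes "half_orientation n k E x"
  shows "\<exists>x'. half_orientation n k (E - {e}) x' \<and> (\<forall>u v. {u, v} \<noteq> e \<longrightarrow> x' (u, v) = x (u, v))"
proof -
  define x' where "x' p = (if {fst p, snd p} = e then 0 else x p)" for p
  have "out_weight n x' u \<le> out_weight n x u" for u
    unfolding out_weight_def by (intro sum_mono) (auto simp: x'_def)
  moreover have "x' (u, v) + x' (v, u) = (if {u, v} \<in> E - {e} then 2 else 0)" for u v
  proof (cases "{u, v} = e")
    case True
    thus ?thesis by (simp add: x'_def insert_commute)
  next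
    case False
    moreover have "{v, u} \<noteq> e" using False by (simp add: insert_commute)
    ultimately show ?thesis using assms by (simp add: x'_def half_orientation_def)
  qed
  ultimately have "half_orientation n k (E - {e}) x'"
    using assms unfolding half_orientation_def by (meson order_trans)
  thus ?thesis by (intro exI[of _ x']) (auto simp: x'_def)
qed

section \<open>Reference orientations along the update sequence\<close>

lemma graph_after_take_Suc:
  "i < length us \<Longrightarrow> graph_after (take (Suc i) us) = apply_update (us ! i) (graph_after (take i us))"
  by (simp add: graph_after_def take_Suc_conv_app_nth)

lemma simple_graph_after:
  assumes "legal_sequence n us" "i \<le> length us"
  shows "simple_graph n (graph_after (take i us))"
  using assms(2)
proof (induction i)
  case 0
  show ?case by (simp add: graph_after_def simple_graph_def)
next
  case (Suc i)
  hence IH: "simple_graph n (graph_after (take i us))" and i: "i < length us" by auto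
  have "legal_update n (graph_after (take i us)) (us ! i)"
    using assms(1) i by (simp add: legal_sequence_def)
  with IH show ?case
    unfolding graph_after_take_Suc[OF i] by (cases "us ! i") (auto simp: simple_graph_def)
qed

text \<open>Sums are compared only over pairs that are edges before the update: the weights of a
  freshly inserted edge go from total 0 to total 2, but this edge is not yet in the digraph.\<close>

lemma half_orientation_sequence:
  assumes legal: "legal_sequence n us" and arb: "arboricity_bounded a us"
    and long: "n * (2 * a) ^ l < (2 * a + 1) ^ l"
  shows "\<exists>xs. \<forall>i \<le> length us. half_orientation n (2 * a + 1) (graph_after (take i us)) (xs i) \<and>
    (i < length us \<longrightarrow> (\<forall>F. finite F \<longrightarrow> (\<forall>(u, v) \<in> F. {u, v} \<in> graph_after (take i us)) \<longrightarrow>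
      sum (xs (Suc i)) F \<le> sum (xs i) F + (if is_insertion (us ! i) then 0 else 2 * l)))"
proof -
  let ?N = "length us"
  define E where "E i = graph_after (take i us)" for i
  have simple: "simple_graph n (E i)" if "i \<le> ?N" for i
    using simple_graph_after[OF legal that] by (simp add: E_def)
  have sparse: "sparse a (E i)" if "i \<le> ?N" for i
    using sparse_if_arboricity_le[OF simple[OF that]] arb that by (simp add: arboricity_bounded_def E_def)
  define step where "step i x y \<longleftrightarrow> (\<forall>F. finite F \<longrightarrow> (\<forall>(u, v) \<in> F. {u, v} \<in> E i) \<longrightarrow>
      sum y F \<le> sum x F + (if is_insertion (us ! i) then 0 else 2 * l))" for i and x y :: weights
  have backwards: "\<exists>x. half_orientation n (2 * a + 1) (E i) x \<and> step i x y"
    if i: "i < ?N" and y: "half_orientation n (2 * a + 1) (E (Suc i)) y" for i y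
  proof (cases "us ! i")
    case (Insert u v)
    have "E (Suc i) = insert {u, v} (E i)" using graph_after_take_Suc[OF i] Insert by (simp add: E_def)
    moreover have new: "{u, v} \<notin> E i" using legal i Insert by (auto simp: legal_sequence_def E_def)
    ultimately have "E (Suc i) - {{u, v}} = E i" by auto
    with half_orientation_delete[OF y, of "{u, v}"] obtain x where
      x: "half_orientation n (2 * a + 1) (E i) x" "\<And>p q. {p, q} \<noteq> {u, v} \<Longrightarrow> x (p, q) = y (p, q)"
      by metis
    have "sum y F = sum x F" if "\<forall>(p, q) \<in> F. {p, q} \<in> E i" for F
    proof (rule sum.cong[OF refl])
      fix e assume "e \<in> F"
      obtain p q where e: "e = (p, q)" by force
      have "{p, q} \<noteq> {u, v}" using that new \<open>e \<in> F\<close> e by auto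
      thus "y e = x e" using x(2) e by simp
    qed
    thus ?thesis using x(1) Insert by (auto simp: step_def)
  next
    case (Delete u v)
    have "{u, v} \<in> E i" using legal i Delete by (auto simp: legal_sequence_def E_def)
    moreover have "E (Suc i) = E i - {{u, v}}" using graph_after_take_Suc[OF i] Delete by (simp add: E_def)
    ultimately have Ei: "E i = insert {u, v} (E (Suc i))" "{u, v} \<notin> E (Suc i)" by auto
    have "\<exists>x. half_orientation n (2 * a + 1) (E i) x \<and> (\<forall>F. finite F \<longrightarrow> sum y F \<le> sum x F + 2 * l)"
      unfolding Ei(1)
      by (rule half_orientation_insert[OF _ _ Ei(2) y long]) (use simple[of i] sparse[of i] i Ei in auto)
    thus ?thesis using Delete by (auto simp: step_def)
  qed
  have "\<exists>x. half_orientation n (2 * a + 1) (E (?N - 0)) x"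
    using half_orientation_exists[OF simple sparse long] by simp
  \<comment> \<open>The index \<open>j\<close> counts from the end. Beyond \<open>?N\<close> the
    truncated subtraction stays at 0 and \<open>step\<close> is not demanded, so that dependent
    choice can produce an infinite sequence.\<close>
  moreover have "\<exists>x. half_orientation n (2 * a + 1) (E (?N - Suc j)) x \<and>
      (Suc j \<le> ?N \<longrightarrow> step (?N - Suc j) x y)"
    if y: "half_orientation n (2 * a + 1) (E (?N - j)) y" for j y
  proof (cases "Suc j \<le> ?N")
    case True
    hence "Suc (?N - Suc j) = ?N - j" by simp
    thus ?thesis using backwards[of "?N - Suc j" y] y True by auto
  next
    case False
    thus ?thesis using y by auto
  qed
  ultimately obtain f where f: "\<And>j. half_orientation n (2 * a + 1) (E (?N - j)) (f j)"
      "\<And>j. Suc j \<le> ?N \<Longrightarrow> step (?N - Suc j) (f (Suc j)) (f j)"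
    using dependent_nat_choice[of "\<lambda>j. half_orientation n (2 * a + 1) (E (?N - j))"
        "\<lambda>j y x. Suc j \<le> ?N \<longrightarrow> step (?N - Suc j) x y"] by auto
  have "half_orientation n (2 * a + 1) (E i) (f (?N - i))" if "i \<le> ?N" for i
    using f(1)[of "?N - i"] that by simp
  moreover have "step i (f (?N - i)) (f (?N - Suc i))" if "i < ?N" for i
    using f(2)[of "?N - Suc i"] that by (simp add: Suc_diff_Suc)
  ultimately show ?thesis
    unfolding step_def E_def by (intro exI[of _ "\<lambda>i. f (?N - i)"]) auto
qed

section \<open>Resetting a vertex\<close>

definition reset :: "nat \<Rightarrow> (nat \<times> nat) set \<Rightarrow> (nat \<times> nat) set" where
  "reset v D = {e \<in> D. fst e \<noteq> v} \<union> (D `` {v}) \<times> {v}"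

lemma orientation_irrefl: "orientation E D \<Longrightarrow> (v, v) \<notin> D"
  unfolding orientation_def by blast

lemma orientation_antisym: "orientation E D \<Longrightarrow> (u, v) \<in> D \<Longrightarrow> (v, u) \<notin> D"
  unfolding orientation_def by blast

lemma orientation_reset:
  assumes "orientation E D"
  shows "orientation E (reset v D)"
  unfolding orientation_def
proof (intro conjI allI impI)
  fix p q assume "(p, q) \<in> reset v D"
  hence "(p, q) \<in> D \<or> (q, p) \<in> D" by (auto simp: reset_def)
  thus "{p, q} \<in> E" using assms unfolding orientation_def by (metis insert_commute)
next
  fix p q assume "{p, q} \<in> E"
  hence *: "(p, q) \<in> D \<longleftrightarrow> (q, p) \<notin> D" using assms unfolding orientation_def by blast
  hence "p \<noteq> q" by blast
  thus "(p, q) \<in> reset v D \<longleftrightarrow> (q, p) \<notin> reset v D" using * by (auto simp: reset_def)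
qed

text \<open>No edge leaves \<open>v\<close>, so a path that enters \<open>v\<close> ends there, and
  any other path runs in \<open>A\<close>. This serves both resets and the insertion of an edge into
  a sink.\<close>

lemma acyclic_Un_sink:
  assumes "acyclic A" "v \<notin> Domain A" "v \<notin> Domain B" "B \<subseteq> UNIV \<times> {v}"
  shows "acyclic (A \<union> B)"
proof -
  have "q = v \<or> (p, q) \<in> A\<^sup>+" if "(p, q) \<in> (A \<union> B)\<^sup>+" for p q
    using that
  proof (induction rule: trancl_induct)
    case (base q)
    thus ?case using assms(4) by auto
  next
    case (step q r)
    show ?case
    proof (cases "(q, r) \<in> B")
      case True
      thus ?thesis using assms(4) by auto
    next
      case False
      hence "(q, r) \<in> A" using step.hyps by simp
      moreover from this have "q \<noteq> v" using assms(2) by auto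
      ultimately show ?thesis using step.IH by (meson trancl_into_trancl)
    qed
  qed
  moreover have "(v, v) \<notin> (A \<union> B)\<^sup>+" using assms(2,3) by (auto dest: tranclD)
  ultimately show ?thesis using assms(1) unfolding acyclic_def by metis
qed

lemma acyclic_reset:
  assumes "acyclic D" "orientation E D"
  shows "acyclic (reset v D)"
  unfolding reset_def
proof (rule acyclic_Un_sink)
  show "acyclic {e \<in> D. fst e \<noteq> v}" using assms(1) by (rule acyclic_subset) auto
qed (use orientation_irrefl[OF assms(2), of v] in auto)

text \<open>Number of half-edges on which the digraph disagrees with the reference orientation.\<close>

definition disagreement :: "weights \<Rightarrow> (nat \<times> nat) set \<Rightarrow> nat" where
  "disagreement x D = sum x (D\<inverse>)"

text \<open>An out-edge from \<open>v\<close> to \<open>y\<close> counts \<open>x (y, v)\<close>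
  before the reset and \<open>x (v, y)\<close> afterwards, two numbers with sum 2; the latter total
  at most \<open>k\<close>. Written without subtraction, the inequality also bounds the rise when
  the out-degree is below \<open>k\<close>.\<close>

lemma disagreement_reset:
  assumes "finite D" "orientation E D" "simple_graph n E" "v < n"
    and tot: "\<And>p q. {p, q} \<in> E \<Longrightarrow> x (p, q) + x (q, p) = 2"
    and out: "out_weight n x v \<le> k"
  shows "disagreement x (reset v D) + 2 * card (D `` {v}) \<le> disagreement x D + 2 * k"
proof -
  let ?A = "{e \<in> D. fst e \<noteq> v}" and ?N = "D `` {v}"
  define s where "s = (\<Sum>y \<in> ?N. x (v, y))"
  have fin: "finite ?A" "finite ?N" using assms(1) by (auto intro: finite_Image)
  have D: "D\<inverse> = ?A\<inverse> \<union> ?N \<times> {v}" by auto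
  have R: "(reset v D)\<inverse> = ?A\<inverse> \<union> {v} \<times> ?N" by (auto simp: reset_def)
  have E: "{v, y} \<in> E" if "y \<in> ?N" for y using that assms(2) unfolding orientation_def by blast
  have "sum x (?N \<times> {v}) = (\<Sum>y \<in> ?N. \<Sum>z \<in> {v}. x (y, z))" by (simp only: sum.cartesian_product) simp
  hence N1: "sum x (?N \<times> {v}) = (\<Sum>y \<in> ?N. x (y, v))" by simp
  have "sum x ({v} \<times> ?N) = (\<Sum>z \<in> {v}. \<Sum>y \<in> ?N. x (z, y))" by (simp only: sum.cartesian_product) simp
  hence N2: "sum x ({v} \<times> ?N) = s" by (simp add: s_def)
  have "disagreement x D = sum x (?A\<inverse>) + sum x (?N \<times> {v})"
    unfolding disagreement_def D using fin by (intro sum.union_disjoint) auto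
  moreover have "disagreement x (reset v D) = sum x (?A\<inverse>) + sum x ({v} \<times> ?N)"
    unfolding disagreement_def R
    using fin orientation_antisym[OF assms(2)] by (intro sum.union_disjoint) auto
  moreover have "s + (\<Sum>y \<in> ?N. x (y, v)) = 2 * card ?N"
    unfolding s_def sum.distrib[symmetric] using tot[OF E] by simp
  moreover have "?N \<subseteq> {..<n}" using E simple_graph_edgeD[OF assms(3)] by blast
  hence "s \<le> out_weight n x v" unfolding s_def out_weight_def by (intro sum_mono2) auto
  hence "s \<le> k" using out by simp
  ultimately show ?thesis unfolding N1 N2 by linarith
qed

section \<open>Weakest preconditions with elapsed time\<close>

text \<open>Termination is included since a run must exist. Passing the elapsed time to
  \<open>Q\<close> makes sequencing plain composition in \<open>wp_Seq\<close> and time bounds part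
  of the postcondition.\<close>

definition wp :: "nat \<Rightarrow> com \<Rightarrow> (state \<Rightarrow> nat \<Rightarrow> bool) \<Rightarrow> state \<Rightarrow> nat \<Rightarrow> bool" where
  "wp w c Q s t \<longleftrightarrow> (\<exists>t' s'. exec w c s t' s' \<and> Q s' (t + t'))"

inductive_cases exec_SkipE: "exec w Skip s t s'"
inductive_cases exec_AssignE: "exec w (Assign r e) s t s'"
inductive_cases exec_StoreE: "exec w (Store e1 e2) s t s'"
inductive_cases exec_SeqE: "exec w (Seq c1 c2) s t s'"
inductive_cases exec_CondE: "exec w (Cond e c1 c2) s t s'"
inductive_cases exec_WhileE: "exec w (While e c) s t s'"

lemma wp_Skip: "wp w Skip Q s t \<longleftrightarrow> Q s (t + 1)"
  unfolding wp_def using exec.Skip[of w s] by (metis exec_SkipE)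

lemma wp_Assign:
  "wp w (Assign r e) Q (R, H) t \<longleftrightarrow> Q (R(r := expr_value w (R, H) e), H) (t + (1 + expr_time e))"
  unfolding wp_def using exec.Assign[of w r e R H] by (metis exec_AssignE prod.inject)

lemma wp_Store:
  "wp w (Store e1 e2) Q (R, H) t \<longleftrightarrow>
     Q (R, H(expr_value w (R, H) e1 := expr_value w (R, H) e2)) (t + (1 + expr_time e1 + expr_time e2))"
  unfolding wp_def using exec.Store[of w e1 e2 R H] by (metis exec_StoreE prod.inject)

lemma wp_Seq: "wp w (Seq c1 c2) Q = wp w c1 (wp w c2 Q)"
proof (intro ext iffI)
  fix s t assume "wp w (Seq c1 c2) Q s t"
  then obtain t' s' where "exec w (Seq c1 c2) s t' s'" "Q s' (t + t')" unfolding wp_def by blast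
  moreover from this(1) obtain t1 s1 t2 where "exec w c1 s t1 s1" "exec w c2 s1 t2 s'" "t' = t1 + t2"
    by (rule exec_SeqE)
  ultimately show "wp w c1 (wp w c2 Q) s t" unfolding wp_def by (metis add.assoc)
next
  fix s t assume "wp w c1 (wp w c2 Q) s t"
  then obtain t1 s1 t2 s2 where "exec w c1 s t1 s1" "exec w c2 s1 t2 s2" "Q s2 (t + t1 + t2)"
    unfolding wp_def by auto
  thus "wp w (Seq c1 c2) Q s t"
    unfolding wp_def by (metis exec.Seq add.assoc)
qed

lemma wp_Cond:
  "wp w (Cond e c1 c2) Q s t \<longleftrightarrow> wp w (if expr_value w s e \<noteq> 0 then c1 else c2) Q s (t + (1 + expr_time e))"
proof
  assume "wp w (Cond e c1 c2) Q s t"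
  then obtain t' s' where "exec w (Cond e c1 c2) s t' s'" "Q s' (t + t')" unfolding wp_def by blast
  moreover from this(1) have "\<exists>t1. exec w (if expr_value w s e \<noteq> 0 then c1 else c2) s t1 s' \<and>
      t' = 1 + expr_time e + t1"
    by (elim exec_CondE) auto
  then obtain t1 where "exec w (if expr_value w s e \<noteq> 0 then c1 else c2) s t1 s'"
    "t' = 1 + expr_time e + t1" by blast
  ultimately show "wp w (if expr_value w s e \<noteq> 0 then c1 else c2) Q s (t + (1 + expr_time e))"
    unfolding wp_def by (intro exI[of _ t1] exI[of _ s']) (simp add: add.assoc)
next
  assume "wp w (if expr_value w s e \<noteq> 0 then c1 else c2) Q s (t + (1 + expr_time e))"
  then obtain t1 s1 where *: "exec w (if expr_value w s e \<noteq> 0 then c1 else c2) s t1 s1"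
    "Q s1 (t + (1 + expr_time e + t1))"
    unfolding wp_def by (auto simp: add.assoc)
  have "exec w (Cond e c1 c2) s (1 + expr_time e + t1) s1"
    using *(1) exec.CondTrue[of w s e c1 t1 s1 c2] exec.CondFalse[of w s e c2 t1 s1 c1]
    by (cases "expr_value w s e = 0") simp_all
  thus "wp w (Cond e c1 c2) Q s t" unfolding wp_def using *(2) by blast
qed

text \<open>A single unfolding without an invariant; each loop below is handled by induction on its
  own measure.\<close>

lemma wp_WhileI:
  assumes "expr_value w s e = 0 \<Longrightarrow> Q s (t + (1 + expr_time e))"
    and "expr_value w s e \<noteq> 0 \<Longrightarrow> wp w c (wp w (While e c) Q) s (t + (1 + expr_time e))"
  shows "wp w (While e c) Q s t"
proof (cases "expr_value w s e = 0")
  case True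
  thus ?thesis unfolding wp_def
    using assms(1) exec.WhileFalse[OF True, of c] by (intro exI[of _ "1 + expr_time e"] exI[of _ s]) simp
next
  case False
  then obtain t1 s1 t2 s2 where "exec w c s t1 s1" "exec w (While e c) s1 t2 s2"
      "Q s2 (t + (1 + expr_time e) + t1 + t2)"
    using assms(2) unfolding wp_def by auto
  with exec.WhileTrue[OF False this(1,2)] show ?thesis
    unfolding wp_def by (intro exI[of _ "1 + expr_time e + t1 + t2"] exI[of _ s2]) (simp add: add.assoc)
qed

section \<open>The adjacency arrays\<close>

definition cell :: "nat \<Rightarrow> nat \<Rightarrow> nat \<Rightarrow> nat" where
  "cell n z i = z * (n + 1) + i"

lemma cell_eq_iff: "i \<le> n \<Longrightarrow> j \<le> n \<Longrightarrow> cell n z i = cell n y j \<longleftrightarrow> z = y \<and> i = j"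
proof -
  have *: "cell n z i div (n + 1) = z" if "i \<le> n" for z i
    unfolding cell_def by (subst div_mult_self3) (use that in simp_all)
  assume "i \<le> n" "j \<le> n"
  moreover have "i = j" if "cell n z i = cell n z j" using that by (simp add: cell_def)
  ultimately show ?thesis using *[of i z] *[of j y] by metis
qed

lemma cell_0_add: "cell n z 0 + i = cell n z i"
  by (simp add: cell_def)

lemma Suc_cell: "Suc (cell n z i) = cell n z (Suc i)"
  by (simp add: cell_def)

definition rows :: "nat \<Rightarrow> memory \<Rightarrow> (nat \<Rightarrow> nat list) \<Rightarrow> bool" where
  "rows n H L \<longleftrightarrow> (\<forall>z < n. H (cell n z 0) = length (L z) \<and> length (L z) \<le> n \<and>
     (\<forall>i < length (L z). H (cell n z (Suc i)) = L z ! i))"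

definition digraph :: "nat \<Rightarrow> (nat \<Rightarrow> nat list) \<Rightarrow> (nat \<times> nat) set" where
  "digraph n L = {(u, v). u < n \<and> v \<in> set (L u)}"

definition adjacency :: "nat \<Rightarrow> (nat \<Rightarrow> nat list) \<Rightarrow> bool" where
  "adjacency n L \<longleftrightarrow> (\<forall>u < n. distinct (L u) \<and> (\<forall>v \<in> set (L u). v < n \<and> v \<noteq> u \<and> u \<notin> set (L v)))"

text \<open>The stack occupies the cells behind the last row. It holds the overfull vertices, except
  for the vertex \<open>x\<close> that is being reset.\<close>

definition stack :: "nat \<Rightarrow> nat \<Rightarrow> nat \<Rightarrow> memory \<Rightarrow> (nat \<Rightarrow> nat list) \<Rightarrow> nat \<Rightarrow> bool" where
  "stack n a sp H L x \<longleftrightarrow> (\<exists>stk. sp = length stk \<and> distinct stk \<and>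
     set stk = {z. z < n \<and> z \<noteq> x \<and> 2 * a + 1 < length (L z)} \<and>
     (\<forall>i < length stk. H (cell n n i) = stk ! i))"

lemma rows_out_list: "rows n H L \<Longrightarrow> u < n \<Longrightarrow> out_list n H u = L u"
  unfolding out_list_def rows_def cell_def
  by (intro nth_equalityI) (auto simp: algebra_simps)

lemma digraph_Image: "u < n \<Longrightarrow> digraph n L `` {u} = set (L u)"
  by (auto simp: digraph_def)

lemma rows_append:
  assumes "rows n H L" "y < n" "length (L y) < n"
  shows "rows n (H(cell n y 0 := Suc (length (L y)), cell n y (Suc (length (L y))) := v)) (L(y := L y @ [v]))"
  using assms unfolding rows_def
  by (auto simp: cell_eq_iff nth_append less_Suc_eq)

lemma rows_butlast:
  assumes "rows n H L" "x < n"
  shows "rows n (H(cell n x 0 := length (L x) - 1)) (L(x := butlast (L x)))"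
  using assms unfolding rows_def
  by (auto simp: cell_eq_iff nth_butlast le_diff_conv)

lemma rows_replace:
  assumes "rows n H L" "x < n" "i < length (L x)"
  shows "rows n (H(cell n x (Suc i) := v)) (L(x := (L x)[i := v]))"
  unfolding rows_def
proof (intro allI impI)
  fix z assume z: "z < n"
  have rz: "H (cell n z 0) = length (L z)" "length (L z) \<le> n"
    "\<And>j. j < length (L z) \<Longrightarrow> H (cell n z (Suc j)) = L z ! j"
    using assms(1) z by (simp_all add: rows_def)
  have i: "Suc i \<le> n" using assms unfolding rows_def by fastforce
  let ?H = "H(cell n x (Suc i) := v)" and ?L = "L(x := (L x)[i := v])"
  have len: "length (?L z) = length (L z)" by simp
  have "?H (cell n z (Suc j)) = ?L z ! j" if "j < length (L z)" for j
    using that rz(2) rz(3)[of j] i by (cases "z = x \<and> j = i") (auto simp: cell_eq_iff assms(3))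
  moreover have "?H (cell n z 0) = length (L z)" using rz(1) i by (simp add: cell_eq_iff)
  ultimately show "?H (cell n z 0) = length (?L z) \<and> length (?L z) \<le> n \<and>
      (\<forall>j<length (?L z). ?H (cell n z (Suc j)) = ?L z ! j)"
    unfolding len using rz(2) by blast
qed

lemma rows_stack: "rows n H L \<Longrightarrow> i \<le> n \<Longrightarrow> rows n (H(cell n n i := v)) L"
proof -
  assume L: "rows n H L" and i: "i \<le> n"
  let ?H = "H(cell n n i := v)"
  have same: "?H (cell n z j) = H (cell n z j)" if "z < n" "j \<le> n" for z j
    using that i by (simp add: cell_eq_iff)
  show "rows n ?H L"
    unfolding rows_def
  proof (intro allI impI)
    fix z assume z: "z < n"
    hence rz: "H (cell n z 0) = length (L z)" "length (L z) \<le> n"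
      "\<forall>j<length (L z). H (cell n z (Suc j)) = L z ! j"
      using L by (simp_all add: rows_def)
    have "?H (cell n z (Suc j)) = L z ! j" if "j < length (L z)" for j
      using same[OF z, of "Suc j"] that rz(2,3) by simp
    moreover have "?H (cell n z 0) = length (L z)" using same[OF z, of 0] rz(1) by simp
    ultimately show "?H (cell n z 0) = length (L z) \<and> length (L z) \<le> n \<and>
        (\<forall>j<length (L z). ?H (cell n z (Suc j)) = L z ! j)"
      using rz(2) by blast
  qed
qed

text \<open>Guarantees room for appending \<open>x\<close> to the row of \<open>u\<close>: besides
  \<open>x\<close>, also \<open>u\<close> itself is missing from \<open>L u\<close>.\<close>

lemma adjacency_length_less:
  assumes "adjacency n L" "u < n" "x < n" "x \<notin> set (L u)" "x \<noteq> u"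
  shows "length (L u) < n - 1"
proof -
  have "distinct (L u)" and v: "\<And>v. v \<in> set (L u) \<Longrightarrow> v < n \<and> v \<noteq> u"
    using assms(1,2) unfolding adjacency_def by meson+
  moreover have "set (L u) \<subseteq> {..<n} - {u, x}" using v assms(4) by blast
  ultimately have "length (L u) \<le> card ({..<n} - {u, x})"
    using card_mono[of "{..<n} - {u, x}" "set (L u)"] by (simp add: distinct_card)
  also have "\<dots> = n - 2" using assms by (subst card_Diff_subset) auto
  finally show ?thesis using assms by linarith
qed

section \<open>The programs\<close>

definition base :: "nat \<Rightarrow> expr" where
  "base r = Op Times (Reg r) (Op Plus (Reg 0) (Const 1))"

text \<open>Registers 0 to 3 keep their initial values \<open>n\<close>, \<open>a\<close>, \<open>u\<close>, \<open>v\<close>. Register 4 holds the stack height,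
  5 the vertex being reset, 6 its current out-neighbour, 7 and 8 addresses of rows, except that
  8 is the search position in \<open>remove_code\<close>.\<close>

definition append_code :: "nat \<Rightarrow> nat \<Rightarrow> com" where
  "append_code r s =
     Seq (Assign 8 (base r))
    (Seq (Store (Reg 8) (Op Plus (Heap (Reg 8)) (Const 1)))
    (Seq (Store (Op Plus (Reg 8) (Heap (Reg 8))) (Reg s))
         (Cond (Op Equal (Heap (Reg 8)) (Op Plus (Op Times (Const 2) (Reg 1)) (Const 2)))
           (Seq (Store (Op Plus (base 0) (Reg 4)) (Reg r))
                (Assign 4 (Op Plus (Reg 4) (Const 1))))
           Skip)))"

text \<open>Taking the last out-neighbour makes its removal a mere decrement of the counter.\<close>

definition reset_step :: com where
  "reset_step =
     Seq (Assign 6 (Heap (Op Plus (Reg 7) (Heap (Reg 7)))))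
    (Seq (Store (Reg 7) (Op Minus (Heap (Reg 7)) (Const 1)))
         (append_code 6 5))"

definition reset_code :: com where
  "reset_code = Seq (Assign 7 (base 5)) (While (Heap (Reg 7)) reset_step)"

definition cascade_step :: com where
  "cascade_step =
     Seq (Assign 4 (Op Minus (Reg 4) (Const 1)))
    (Seq (Assign 5 (Heap (Op Plus (base 0) (Reg 4))))
         reset_code)"

text \<open>The product acts as conjunction and the comparison with 0 as negation. Both factors are
  always evaluated: behind the last entry one more cell is read, but this factor is multiplied by
  0.\<close>

definition search_test :: "nat \<Rightarrow> expr" where
  "search_test s =
     Op Times (Op Less (Reg 8) (Op Plus (Heap (Reg 7)) (Const 1)))
       (Op Equal (Op Equal (Heap (Op Plus (Reg 7) (Reg 8))) (Reg s)) (Const 0))"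

text \<open>The gap is filled with the last entry, as order is immaterial. The search starts at
  offset 1 because offset 0 holds the length.\<close>

definition remove_code :: "nat \<Rightarrow> nat \<Rightarrow> com" where
  "remove_code r s =
     Seq (Assign 7 (base r))
    (Seq (Assign 8 (Const 1))
    (Seq (While (search_test s) (Assign 8 (Op Plus (Reg 8) (Const 1))))
         (Cond (Op Less (Reg 8) (Op Plus (Heap (Reg 7)) (Const 1)))
           (Seq (Store (Op Plus (Reg 7) (Reg 8)) (Heap (Op Plus (Reg 7) (Heap (Reg 7)))))
                (Store (Reg 7) (Op Minus (Heap (Reg 7)) (Const 1))))
           Skip)))"

text \<open>An edge is stored in one direction only, and a deletion does not know which, so both are
  tried. Register 4 starts at 0, that is, with an empty stack.\<close>

definition orientation_algorithm :: algorithm where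
  "orientation_algorithm =
     \<lparr>insert_code = Seq (Assign 5 (Reg 3)) (Seq reset_code (Seq (append_code 2 3) (While (Reg 4) cascade_step))),
      delete_code = Seq (remove_code 2 3) (remove_code 3 2)\<rparr>"

text \<open>Addresses reach at most \<open>n * (n + 1) + n\<close>, other numbers at most
  \<open>n + 1\<close> or \<open>2 * a + 2\<close>; with exponent 2 no sum or product of the
  programs wraps around.\<close>

locale word_size =
  fixes n a w :: nat
  assumes word_size: "(n + a + 2) ^ 2 \<le> 2 ^ w"
begin

lemma less_word: "k < (n + a + 2) ^ 2 \<Longrightarrow> k < 2 ^ w"
  using word_size by simp

lemma cell_less_word: "z \<le> n \<Longrightarrow> i \<le> n \<Longrightarrow> cell n z i < 2 ^ w"
proof (rule less_word)
  assume "z \<le> n" "i \<le> n"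
  hence "cell n z i \<le> n * (n + 1) + n" unfolding cell_def by (intro add_mono mult_le_mono1)
  also have "\<dots> < (n + a + 2) ^ 2" by (simp add: power2_eq_square algebra_simps)
  finally show "cell n z i < (n + a + 2) ^ 2" .
qed

lemma small_less_word: "k \<le> 2 * n + 2 * a + 2 \<Longrightarrow> k < 2 ^ w"
  by (rule less_word) (simp add: power2_eq_square algebra_simps)

lemma word_pos: "0 < w"
  using small_less_word[of 1] by (cases w) auto

lemma base_time: "expr_time (base r) = 5"
  by (simp add: base_def)

lemma base_value: "R 0 = n \<Longrightarrow> R r = z \<Longrightarrow> z \<le> n \<Longrightarrow> expr_value w (R, H) (base r) = cell n z 0"
  using cell_less_word[of z 0] small_less_word[of "n + 1"] word_pos
  by (simp add: base_def cell_def)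

text \<open>The list grows by one entry, so equality with \<open>2 * a + 2\<close> recognises the
  moment at which \<open>y\<close> becomes overfull. It is pushed exactly then, which keeps the
  stack free of repetitions. The branch that pushes takes the full 40 time units.\<close>

lemma wp_append:
  assumes R: "R 0 = n" "R 1 = a" "R r = y" "R s = v" and regs: "r \<notin> {4, 8}" "s \<notin> {4, 8}"
    and y: "y < n" "y \<noteq> x" and H: "rows n H L" "length (L y) < n" "stack n a (R 4) H L x"
    and post: "\<And>R' H' t'. (\<And>i. i \<noteq> 4 \<Longrightarrow> i \<noteq> 8 \<Longrightarrow> R' i = R i) \<Longrightarrow>
      rows n H' (L(y := L y @ [v])) \<Longrightarrow> stack n a (R' 4) H' (L(y := L y @ [v])) x \<Longrightarrow>
      t' \<le> t + 40 \<Longrightarrow> Q (R', H') t'"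
  shows "wp w (append_code r s) Q (R, H) t"
proof -
  let ?L = "L(y := L y @ [v])" and ?l = "length (L y)"
  define H' where "H' = H(cell n y 0 := Suc ?l, cell n y (Suc ?l) := v)"
  have rows': "rows n H' ?L" unfolding H'_def by (rule rows_append) (use H y in auto)
  have H0: "H (cell n y 0) = ?l" using H(1) y by (auto simp: rows_def)
  have H'0: "H' (cell n y 0) = Suc ?l" using rows' y by (auto simp: rows_def)
  have [simp]: "2 mod 2 ^ w = (2::nat)" "Suc ?l mod 2 ^ w = Suc ?l"
     "2 * a mod 2 ^ w = 2 * a" "(2 * a + 2) mod 2 ^ w = 2 * a + 2" "Suc (Suc (2 * a)) mod 2 ^ w = 2 * a + 2"
    using small_less_word[of 2] small_less_word[of "Suc ?l"]
      small_less_word[of "2 * a"] small_less_word[of "2 * a + 2"] H(2) by simp_all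
  have [simp]: "0 < w" by (rule word_pos)
  have addr: "cell n y (Suc ?l) mod 2 ^ w = cell n y (Suc ?l)" "cell n y 0 \<noteq> cell n y (Suc ?l)"
    using cell_less_word[of y "Suc ?l"] y H(2) by (simp_all add: cell_eq_iff)
  obtain stk where stk: "R 4 = length stk" "distinct stk"
    "set stk = {z. z < n \<and> z \<noteq> x \<and> 2 * a + 1 < length (L z)}" "\<forall>i < length stk. H (cell n n i) = stk ! i"
    using H(3) by (auto simp: stack_def)
  have "length stk = card (set stk)" using stk(2) by (simp add: distinct_card)
  also have "\<dots> \<le> card {..<n}" by (rule card_mono) (auto simp: stk(3))
  finally have "length stk \<le> n" by simp
  have stk': "\<forall>i < length stk. H' (cell n n i) = stk ! i"
    using stk(4) y H(2) \<open>length stk \<le> n\<close> by (auto simp: H'_def cell_eq_iff)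
  show ?thesis
  proof (cases "Suc ?l = 2 * a + 2")
    case False
    have "stack n a (R 4) H' ?L x"
      unfolding stack_def using stk(1,2) stk' False by (intro exI[of _ stk]) (auto simp: stk(3))
    thus ?thesis
      unfolding append_code_def
      using False R regs y rows'
      by (simp add: wp_Seq wp_Assign wp_Store wp_Cond wp_Skip base_time base_value[where z = y] H0 cell_0_add
          Suc_cell addr H'_def[symmetric] H'0) (rule post, simp_all)
  next
    case True
    hence l: "?l = Suc (2 * a)" by simp
    \<comment> \<open>As \<open>y\<close> is not on the stack yet, there are fewer than
      \<open>n\<close> entries and the push stays within row \<open>n\<close>.\<close>
    have "y \<notin> set stk" using True by (simp add: stk(3))
    hence "set stk \<subseteq> {..<n} - {y}" by (auto simp: stk(3))
    hence "card (set stk) \<le> card ({..<n} - {y})" by (intro card_mono) auto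
    hence len: "length stk < n" using y by (simp add: distinct_card[OF stk(2)])
    have [simp]: "Suc (length stk) mod 2 ^ w = Suc (length stk)"
       "cell n n (length stk) mod 2 ^ w = cell n n (length stk)"
      using small_less_word[of "Suc (length stk)"] cell_less_word[of n "length stk"] len by simp_all
    have "rows n (H'(cell n n (length stk) := y)) ?L" using rows' len by (intro rows_stack) auto
    moreover have "stack n a (Suc (length stk)) (H'(cell n n (length stk) := y)) ?L x"
      unfolding stack_def using stk(2) stk' True \<open>y \<notin> set stk\<close> y len
      by (intro exI[of _ "stk @ [y]"]) (auto simp: stk(3) cell_eq_iff nth_append less_Suc_eq)
    ultimately show ?thesis
      unfolding append_code_def
      using True R regs y stk(1)
      by (simp add: wp_Seq wp_Assign wp_Store wp_Cond wp_Skip base_time base_value[where z = y]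
          base_value[where z = n and r = 0] l H0[unfolded l] cell_0_add
          Suc_cell addr[unfolded l] H'_def[unfolded l, symmetric] H'0[unfolded l]) (rule post, simp_all)
  qed
qed

end

section \<open>Lists and stack under single changes\<close>

lemma adjacency_iff:
  "adjacency n L \<longleftrightarrow> (\<forall>u < n. distinct (L u)) \<and>
     (\<forall>u v. (u, v) \<in> digraph n L \<longrightarrow> v < n \<and> u \<noteq> v \<and> (v, u) \<notin> digraph n L)"
  unfolding adjacency_def digraph_def by blast

lemma finite_digraph: "finite (digraph n L)"
proof -
  have "digraph n L = (\<Union>u \<in> {..<n}. {u} \<times> set (L u))" by (auto simp: digraph_def)
  thus ?thesis by simp
qed

lemma outdegree_digraph: "adjacency n L \<Longrightarrow> u < n \<Longrightarrow> card (digraph n L `` {u}) = length (L u)"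
  unfolding digraph_Image adjacency_def by (simp add: distinct_card)

text \<open>One pass of the reset loop. The last equation drives the induction: reversing one
  out-edge of \<open>x\<close> leaves the final result \<open>reset x\<close> unchanged.\<close>

lemma adjacency_flip:
  assumes adj: "adjacency n L" and x: "x < n" "L x \<noteq> []" and y: "y = last (L x)"
  defines "L' \<equiv> L(x := butlast (L x), y := L y @ [x])"
  shows "y < n" "y \<noteq> x" "x \<notin> set (L y)"
    "digraph n L' = insert (y, x) (digraph n L - {(x, y)})"
    "adjacency n L'" "reset x (digraph n L') = reset x (digraph n L)"
proof -
  let ?D = "digraph n L"
  have Lx: "L x = butlast (L x) @ [y]" using x(2) y by simp
  have d: "distinct (L u)" if "u < n" for u using adj that by (simp add: adjacency_def)
  have "(x, y) \<in> ?D" using x y by (auto simp: digraph_def)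
  hence xy: "y < n" "y \<noteq> x" "(y, x) \<notin> ?D" using adj unfolding adjacency_iff by metis+
  thus "y < n" "y \<noteq> x" and nx: "x \<notin> set (L y)" by (simp_all add: digraph_def)
  have dx: "distinct (butlast (L x) @ [y])" using d[OF x(1)] Lx by metis
  have sx: "set (L x) = insert y (set (butlast (L x)))" by (subst Lx) simp
  hence sb: "set (butlast (L x)) = set (L x) - {y}" using dx by auto
  show D': "digraph n L' = insert (y, x) (?D - {(x, y)})"
    using xy(1,2) x(1) unfolding digraph_def L'_def by (auto simp: sb split: if_splits)
  have "distinct (L' u)" if "u < n" for u
    using d[OF that] dx nx xy(2) by (auto simp: L'_def)
  moreover have "q < n \<and> p \<noteq> q \<and> (q, p) \<notin> digraph n L'" if "(p, q) \<in> digraph n L'" for p q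
    using that adj xy x(1) unfolding D' adjacency_iff by blast
  ultimately show "adjacency n L'" unfolding adjacency_iff by blast
  show "reset x (digraph n L') = reset x ?D"
    unfolding D' reset_def using xy(2) \<open>(x, y) \<in> ?D\<close> by auto
qed

text \<open>Vertex rows and stack do not overlap, and the list of the exempt vertex \<open>x\<close>
  may change freely.\<close>

lemma stack_cong:
  assumes "stack n a sp H L x" "z < n" "i \<le> n" "\<And>u. u \<noteq> x \<Longrightarrow> L' u = L u"
  shows "stack n a sp (H(cell n z i := c)) L' x"
proof -
  obtain stk where stk: "sp = length stk" "distinct stk"
    "set stk = {z. z < n \<and> z \<noteq> x \<and> 2 * a + 1 < length (L z)}"
    "\<And>i. i < length stk \<Longrightarrow> H (cell n n i) = stk ! i"
    using assms(1) by (auto simp: stack_def)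
  have "card (set stk) \<le> card {..<n}" by (rule card_mono) (auto simp: stk(3))
  hence "length stk \<le> n" using stk(2) by (simp add: distinct_card)
  hence "(H(cell n z i := c)) (cell n n j) = stk ! j" if "j < length stk" for j
    using stk(4)[OF that] that assms(2,3) by (simp add: cell_eq_iff)
  moreover have "set stk = {z. z < n \<and> z \<noteq> x \<and> 2 * a + 1 < length (L' z)}"
    using assms(4) by (auto simp: stk(3))
  ultimately show ?thesis unfolding stack_def using stk(1,2) by blast
qed

text \<open>As \<open>n\<close> is not a vertex, exempting \<open>n\<close> exempts nothing; a
  vertex just reset has no out-edges and is not overfull.\<close>

lemma stack_exempt:
  assumes "stack n a sp H L x" "L x = []"
  shows "stack n a sp H L n"
proof -
  have "{z. z < n \<and> z \<noteq> x \<and> 2 * a + 1 < length (L z)} = {z. z < n \<and> z \<noteq> n \<and> 2 * a + 1 < length (L z)}"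
    using assms(2) by auto
  thus ?thesis using assms(1) unfolding stack_def by simp
qed

lemma stack_empty:
  assumes "\<And>z. z < n \<Longrightarrow> length (L z) \<le> 2 * a + 1"
  shows "stack n a 0 H L x"
  unfolding stack_def using assms by (intro exI[of _ "[]"]) (auto simp: not_less)

text \<open>The popped vertex is still overfull; it becomes the exempt vertex until its reset is
  finished.\<close>

lemma stack_pop:
  assumes "stack n a sp H L n" "sp \<noteq> 0"
  obtains v where "H (cell n n (sp - 1)) = v" "v < n" "2 * a + 1 < length (L v)"
    "stack n a (sp - 1) H L v" "sp \<le> n"
proof -
  obtain stk where stk: "sp = length stk" "distinct stk"
    "set stk = {z. z < n \<and> z \<noteq> n \<and> 2 * a + 1 < length (L z)}"
    "\<And>i. i < length stk \<Longrightarrow> H (cell n n i) = stk ! i"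
    using assms(1) by (auto simp: stack_def)
  have "card (set stk) \<le> card {..<n}" by (rule card_mono) (auto simp: stk(3))
  hence "sp \<le> n" using stk(1,2) by (simp add: distinct_card)
  define v where "v = last stk"
  have split: "stk = butlast stk @ [v]" and "v \<in> set stk" using assms(2) stk(1) by (auto simp: v_def)
  have "distinct (butlast stk @ [v])" using stk(2) split by metis
  moreover have "set stk = insert v (set (butlast stk))" by (subst split) simp
  ultimately have "set (butlast stk) = {z. z < n \<and> z \<noteq> v \<and> 2 * a + 1 < length (L z)}"
    using stk(3) by auto
  moreover have "H (cell n n i) = butlast stk ! i" if "i < length (butlast stk)" for i
    using stk(4)[of i] that by (simp add: nth_butlast)
  ultimately have "stack n a (sp - 1) H L v"
    unfolding stack_def using stk(1,2) by (intro exI[of _ "butlast stk"]) (auto simp: distinct_butlast)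
  moreover have "H (cell n n (sp - 1)) = v"
    using stk(4)[of "sp - 1"] assms(2) stk(1) by (simp add: v_def last_conv_nth)
  ultimately show ?thesis using that \<open>v \<in> set stk\<close> \<open>sp \<le> n\<close> by (auto simp: stk(3))
qed

lemma swap_delete:
  assumes "distinct ys" "i < length ys" "ys ! i = v"
  shows "distinct (butlast (ys[i := last ys]))" "set (butlast (ys[i := last ys])) = set ys - {v}"
proof -
  obtain zs z where ys: "ys = zs @ [z]" using assms(2) by (cases ys rule: rev_cases) auto
  have "distinct (butlast (ys[i := last ys])) \<and> set (butlast (ys[i := last ys])) = set ys - {v}"
  proof (cases "i = length zs")
    case True
    thus ?thesis using assms ys by auto
  next
    case False
    hence "i < length zs" "zs ! i = v" using assms ys by (auto simp: nth_append)
    moreover from this have "v \<in> set zs" by auto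
    ultimately show ?thesis
      using assms(1) ys by (auto simp: list_update_append distinct_list_update set_update_distinct)
  qed
  thus "distinct (butlast (ys[i := last ys]))" "set (butlast (ys[i := last ys])) = set ys - {v}" by auto
qed

text \<open>A reset at out-degree \<open>2 * a + 1 + e\<close> with \<open>e \<ge> 1\<close> takes at most \<open>60 * (2 * a + 2 + e)\<close>, hence at most
  \<open>overhead a * e\<close>, time units and lowers the disagreement by at least \<open>2 * e\<close>.\<close>

definition overhead :: "nat \<Rightarrow> nat" where
  "overhead a = 60 * (2 * a + 3)"

section \<open>Resets and the cascade\<close>

context word_size
begin

text \<open>During the loop \<open>x\<close> may be overfull without being on the stack, while
  vertices that gain an edge are pushed as soon as they exceed the bound.\<close>

lemma wp_reset_loop:
  assumes "R 0 = n" "R 1 = a" "R 5 = x" "R 7 = cell n x 0" "x < n"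
    and "rows n H L" "adjacency n L" "stack n a (R 4) H L x"
    and "\<And>R' H' L' t'. (\<And>i. i \<notin> {4, 6, 8} \<Longrightarrow> R' i = R i) \<Longrightarrow> rows n H' L' \<Longrightarrow> adjacency n L' \<Longrightarrow>
      L' x = [] \<Longrightarrow> digraph n L' = reset x (digraph n L) \<Longrightarrow> stack n a (R' 4) H' L' x \<Longrightarrow>
      t' \<le> t + 3 + 60 * length (L x) \<Longrightarrow> Q (R', H') t'"
  shows "wp w (While (Heap (Reg 7)) reset_step) Q (R, H) t"
  using assms
proof (induction "length (L x)" arbitrary: R H L t rule: less_induct)
  case less
  note R = less.prems(1-4) and x = less.prems(5) and H = less.prems(6-8) and post = less.prems(9)
  have H0: "H (cell n x 0) = length (L x)" and len: "length (L x) \<le> n"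
    and nth: "\<And>i. i < length (L x) \<Longrightarrow> H (cell n x (Suc i)) = L x ! i"
    using H(1) x by (auto simp: rows_def)
  show ?case
  proof (rule wp_WhileI)
    assume "expr_value w (R, H) (Heap (Reg 7)) = 0"
    hence nil: "L x = []" using R H0 by simp
    hence "digraph n L = reset x (digraph n L)" by (auto simp: digraph_def reset_def)
    thus "Q (R, H) (t + (1 + expr_time (Heap (Reg 7))))"
      using H nil by (intro post) auto
  next
    assume "expr_value w (R, H) (Heap (Reg 7)) \<noteq> 0"
    hence ne: "L x \<noteq> []" using R H0 by simp
    define y where "y = last (L x)"
    define L1 where "L1 = L(x := butlast (L x))"
    define H1 where "H1 = H(cell n x 0 := length (L x) - 1)"
    note flip_x = adjacency_flip[OF H(2) x ne y_def]
    have Hy: "H (cell n x (length (L x))) = y"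
      using nth[of "length (L x) - 1"] ne by (simp add: y_def last_conv_nth)
    have L1: "L1 y = L y" "length (L1 x) < length (L x)" using flip_x(2) ne by (simp_all add: L1_def)
    have rows1: "rows n H1 L1" unfolding H1_def L1_def by (rule rows_butlast[OF H(1) x])
    have stack1: "stack n a (R 4) H1 L1 x"
      unfolding H1_def by (rule stack_cong[OF H(3) x]) (simp_all add: L1_def)
    have "length (L y) < n"
      using adjacency_length_less[OF H(2) flip_x(1) x flip_x(3)] flip_x(2) by simp
    hence lenL1: "length (L1 y) < n" using L1(1) by simp
    have arith: "cell n x (length (L x)) mod 2 ^ w = cell n x (length (L x))"
        "(2 ^ w + length (L x) - 1) mod 2 ^ w = length (L x) - 1"
    proof -
      show "cell n x (length (L x)) mod 2 ^ w = cell n x (length (L x))"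
        using cell_less_word[of x "length (L x)"] x len by simp
      have "2 ^ w + length (L x) - 1 = length (L x) - 1 + 2 ^ w" using ne by (cases "L x") auto
      moreover have "length (L x) - 1 < 2 ^ w" using small_less_word[of "length (L x) - 1"] len by simp
      ultimately show "(2 ^ w + length (L x) - 1) mod 2 ^ w = length (L x) - 1"
        by (simp only: mod_add_self2 mod_less)
    qed
    \<comment> \<open>Loop test and the first two statements take 3 + 6 + 6 time units; with 40 for
      \<open>append_code\<close> a pass stays below 60.\<close>
    have "wp w (append_code 6 5) (wp w (While (Heap (Reg 7)) reset_step) Q) (R(6 := y), H1) (t + 15)"
    proof (rule wp_append[where y = y and v = x and x = x and L = L1])
      fix R' H' t'
      assume R': "\<And>i. i \<noteq> 4 \<Longrightarrow> i \<noteq> 8 \<Longrightarrow> R' i = (R(6 := y)) i"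
        and H': "rows n H' (L1(y := L1 y @ [x]))" "stack n a (R' 4) H' (L1(y := L1 y @ [x])) x"
        and t': "t' \<le> t + 15 + 40"
      define L2 where "L2 = L(x := butlast (L x), y := L y @ [x])"
      have L2: "L1(y := L1 y @ [x]) = L2" using L1(1) by (simp add: L1_def L2_def)
      have L2x: "length (L2 x) = length (L x) - 1" using flip_x(2) by (simp add: L2_def)
      have ge1: "length (L x) \<ge> 1" using ne by (cases "L x") auto
      show "wp w (While (Heap (Reg 7)) reset_step) Q (R', H') t'"
      proof (rule less.hyps[where L = L2])
        show "length (L2 x) < length (L x)" using L2x ge1 by linarith
        fix R'' H'' L'' t''
        assume *: "\<And>i. i \<notin> {4, 6, 8} \<Longrightarrow> R'' i = R' i" "rows n H'' L''" "adjacency n L''" "L'' x = []"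
          "digraph n L'' = reset x (digraph n L2)"
          "stack n a (R'' 4) H'' L'' x"
          "t'' \<le> t' + 3 + 60 * length (L2 x)"
        show "Q (R'', H'') t''"
        proof (rule post)
          show "R'' i = R i" if "i \<notin> {4, 6, 8}" for i using *(1)[OF that] R'[of i] that by simp
          show "digraph n L'' = reset x (digraph n L)" unfolding *(5) L2_def by (rule flip_x(6))
          show "t'' \<le> t + 3 + 60 * length (L x)" using *(7) t' L2x ge1 by linarith
        qed (use * in auto)
      qed (use R R' H' x flip_x(5) in \<open>simp_all add: L2 flip: L2_def\<close>)
    qed (use R flip_x x rows1 stack1 lenL1 in auto)
    thus "wp w reset_step (wp w (While (Heap (Reg 7)) reset_step) Q) (R, H) (t + (1 + expr_time (Heap (Reg 7))))"
      unfolding reset_step_def using R word_pos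
      by (simp add: wp_Seq wp_Assign wp_Store H0 cell_0_add arith Hy add.assoc flip: H1_def
          del: One_nat_def add_2_eq_Suc add_2_eq_Suc')
  qed
qed

lemma wp_reset:
  assumes R: "R 0 = n" "R 1 = a" "R 5 = x" "x < n"
    and H: "rows n H L" "adjacency n L" "stack n a (R 4) H L x"
    and post: "\<And>R' H' L' t'. (\<And>i. i < 4 \<Longrightarrow> R' i = R i) \<Longrightarrow> rows n H' L' \<Longrightarrow> adjacency n L' \<Longrightarrow>
      L' x = [] \<Longrightarrow> digraph n L' = reset x (digraph n L) \<Longrightarrow> stack n a (R' 4) H' L' x \<Longrightarrow>
      t' \<le> t + 9 + 60 * length (L x) \<Longrightarrow> Q (R', H') t'"
  shows "wp w reset_code Q (R, H) t"
proof -
  have "wp w (While (Heap (Reg 7)) reset_step) Q (R(7 := cell n x 0), H) (t + 6)"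
  proof (rule wp_reset_loop[where x = x and L = L])
    fix R' H' L' t'
    assume *: "\<And>i. i \<notin> {4, 6, 8} \<Longrightarrow> R' i = (R(7 := cell n x 0)) i" "rows n H' L'" "adjacency n L'"
      "L' x = []" "digraph n L' = reset x (digraph n L)" "stack n a (R' 4) H' L' x"
      "t' \<le> t + 6 + 3 + 60 * length (L x)"
    show "Q (R', H') t'" by (rule post) (use * in auto)
  qed (use assms in auto)
  thus ?thesis
    unfolding reset_code_def using R base_value[of R 5 x H]
    by (simp add: wp_Seq wp_Assign base_time add.assoc del: One_nat_def add_2_eq_Suc add_2_eq_Suc')
qed

text \<open>The reference \<open>X\<close> is fixed during the cascade and occurs in the analysis
  only. Induction on the disagreement gives termination, and its drop pays for every reset; the
  final 2 is the last loop test.\<close>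

lemma wp_cascade:
  assumes X: "simple_graph n E" "\<And>p q. {p, q} \<in> E \<Longrightarrow> X (p, q) + X (q, p) = 2"
      "\<And>u. u < n \<Longrightarrow> out_weight n X u \<le> 2 * a + 1"
    and "R 0 = n" "R 1 = a" "rows n H L" "adjacency n L" "stack n a (R 4) H L n"
      "orientation E (digraph n L)" "acyclic (digraph n L)"
    and "\<And>R' H' L' t'. rows n H' L' \<Longrightarrow> adjacency n L' \<Longrightarrow> orientation E (digraph n L') \<Longrightarrow>
      acyclic (digraph n L') \<Longrightarrow> (\<And>z. z < n \<Longrightarrow> length (L' z) \<le> 2 * a + 1) \<Longrightarrow>
      t' + overhead a * disagreement X (digraph n L') \<le> t + 2 + overhead a * disagreement X (digraph n L) \<Longrightarrow>
      Q (R', H') t'"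
  shows "wp w (While (Reg 4) cascade_step) Q (R, H) t"
  using assms(4-)
proof (induction "disagreement X (digraph n L)" arbitrary: R H L t rule: less_induct)
  case less
  note R = less.prems(1,2) and H = less.prems(3-5) and D = less.prems(6,7) and post = less.prems(8)
  show ?case
  proof (rule wp_WhileI)
    assume "expr_value w (R, H) (Reg 4) = 0"
    hence "stack n a 0 H L n" using H(3) by simp
    hence "{z. z < n \<and> z \<noteq> n \<and> 2 * a + 1 < length (L z)} = {}" unfolding stack_def by auto
    hence "\<not> 2 * a + 1 < length (L z)" if "z < n" for z using that by blast
    hence "length (L z) \<le> 2 * a + 1" if "z < n" for z using that by (simp add: not_less)
    thus "Q (R, H) (t + (1 + expr_time (Reg 4)))" using H D by (intro post) auto
  next
    assume "expr_value w (R, H) (Reg 4) \<noteq> 0"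
    hence "R 4 \<noteq> 0" by simp
    then obtain v where v: "H (cell n n (R 4 - 1)) = v" "v < n" "2 * a + 1 < length (L v)"
      "stack n a (R 4 - 1) H L v" "R 4 \<le> n"
      using stack_pop[OF H(3)] by blast
    define k where "k = R 4 - 1"
    have k: "R 4 = Suc k" "k < n" using \<open>R 4 \<noteq> 0\<close> v(5) by (simp_all add: k_def)
    have "wp w reset_code (wp w (While (Reg 4) cascade_step) Q) (R(4 := k, 5 := v), H) (t + 15)"
    proof (rule wp_reset[where x = v and L = L])
      fix R' H' L' t'
      assume R': "\<And>i. i < 4 \<Longrightarrow> R' i = (R(4 := k, 5 := v)) i"
        and H': "rows n H' L'" "adjacency n L'" "L' v = []"
          "digraph n L' = reset v (digraph n L)" "stack n a (R' 4) H' L' v"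
        and t': "t' \<le> t + 15 + 9 + 60 * length (L v)"
      have drop: "disagreement X (digraph n L') + 2 * length (L v) \<le>
          disagreement X (digraph n L) + 2 * (2 * a + 1)"
        using disagreement_reset[OF finite_digraph D(1) X(1) v(2) X(2) X(3)[OF v(2)]]
        unfolding H'(4) outdegree_digraph[OF H(2) v(2)] by simp
      define e where "e = length (L v) - (2 * a + 1)"
      have e: "length (L v) = 2 * a + 1 + e" "e \<ge> 1" using v(3) by (simp_all add: e_def)
      have e': "disagreement X (digraph n L') + e \<le> disagreement X (digraph n L)"
          "disagreement X (digraph n L') < disagreement X (digraph n L)"
        using drop e by simp_all
      have "overhead a * (disagreement X (digraph n L') + e) \<le> overhead a * disagreement X (digraph n L)"
        using e'(1) by (rule mult_le_mono2)
      moreover have "60 * (2 * a + 2 + e) \<le> overhead a * e"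
      proof -
        have "(2 * a + 2) * 1 \<le> (2 * a + 2) * e" using e(2) by (rule mult_le_mono2)
        thus ?thesis by (simp add: overhead_def algebra_simps)
      qed
      \<comment> \<open>The summand 1 provides 60 time units for loop test and pop (15) and for the
        fixed part of the reset (9).\<close>
      ultimately have pot: "60 * (length (L v) + 1) + overhead a * disagreement X (digraph n L') \<le>
          overhead a * disagreement X (digraph n L)"
        using e(1) by (simp add: algebra_simps)
      show "wp w (While (Reg 4) cascade_step) Q (R', H') t'"
      proof (rule less.hyps[OF e'(2)])
        show "orientation E (digraph n L')" unfolding H'(4) by (rule orientation_reset[OF D(1)])
        show "acyclic (digraph n L')" unfolding H'(4) by (rule acyclic_reset[OF D(2,1)])
        show "stack n a (R' 4) H' L' n" by (rule stack_exempt[OF H'(5,3)])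
        fix R'' H'' L'' t''
        assume *: "rows n H'' L''" "adjacency n L''" "orientation E (digraph n L'')"
          "acyclic (digraph n L'')" "\<And>z. z < n \<Longrightarrow> length (L'' z) \<le> 2 * a + 1"
          "t'' + overhead a * disagreement X (digraph n L'') \<le> t' + 2 + overhead a * disagreement X (digraph n L')"
        show "Q (R'', H'') t''"
          by (rule post) (use * t' pot in auto)
      qed (use R R' H' in auto)
    qed (use R v k H in \<open>simp_all flip: k_def\<close>)
    moreover have "(2 ^ w + R 4 - 1) mod 2 ^ w = k"
    proof -
      have "2 ^ w + R 4 - 1 = k + 2 ^ w" using k by simp
      moreover have "k < 2 ^ w" using small_less_word[of k] k by simp
      ultimately show ?thesis by (simp only: mod_add_self2 mod_less)
    qed
    moreover have "cell n n k mod 2 ^ w = cell n n k" using cell_less_word[of n k] k by simp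
    ultimately show "wp w cascade_step (wp w (While (Reg 4) cascade_step) Q) (R, H)
        (t + (1 + expr_time (Reg 4)))"
      unfolding cascade_step_def using R k v(1) word_pos base_value[of "R(4 := k)" 0 n H]
      by (simp add: wp_Seq wp_Assign base_time cell_0_add add.assoc
          del: One_nat_def add_2_eq_Suc add_2_eq_Suc')
  qed
qed

section \<open>Searching and deleting a list entry\<close>

lemma search_time: "expr_time (search_test s) = 15"
  by (simp add: search_test_def)

text \<open>The search stops at the first occurrence or, with \<open>i' = length (L u)\<close>,
  behind the last entry. A pass costs 16 for the test and 4 for the increment.\<close>

lemma wp_search:
  assumes "R 7 = cell n u 0" "R 8 = Suc i" "R s = v" "s \<noteq> 8" "u < n" "rows n H L"
    and "i \<le> length (L u)" "\<And>j. j < i \<Longrightarrow> L u ! j \<noteq> v"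
    and "\<And>i' t'. i' \<le> length (L u) \<Longrightarrow> (\<And>j. j < i' \<Longrightarrow> L u ! j \<noteq> v) \<Longrightarrow>
      (i' < length (L u) \<Longrightarrow> L u ! i' = v) \<Longrightarrow> t' \<le> t + 16 + 20 * (length (L u) - i) \<Longrightarrow>
      Q (R(8 := Suc i'), H) t'"
  shows "wp w (While (search_test s) (Assign 8 (Op Plus (Reg 8) (Const 1)))) Q (R, H) t"
  using assms
proof (induction "length (L u) - i" arbitrary: R i t)
  case (0 i R t)
  note prems = 0
  hence i: "i = length (L u)" by simp
  have H0: "H (cell n u 0) = length (L u)" and len: "length (L u) \<le> n"
    using prems(6,7) by (auto simp: rows_def)
  have [simp]: "Suc (length (L u)) mod 2 ^ w = Suc (length (L u))"
    using small_less_word[of "Suc (length (L u))"] len by simp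
  show ?case
  proof (rule wp_WhileI)
    have "R(8 := Suc i) = R" using prems(3) by auto
    thus "Q (R, H) (t + (1 + expr_time (search_test s)))"
      using prems(10)[of i "t + 16"] prems(9) i by (simp add: search_time)
    \<comment> \<open>Contradictory at the end of the list, where the comparison of positions yields
      0.\<close>
    assume "expr_value w (R, H) (search_test s) \<noteq> 0"
    thus "wp w (Assign 8 (Op Plus (Reg 8) (Const 1)))
        (wp w (While (search_test s) (Assign 8 (Op Plus (Reg 8) (Const 1)))) Q)
        (R, H) (t + (1 + expr_time (search_test s)))"
      using prems(2,3) i H0 word_pos by (simp add: search_test_def)
  qed
next
  case (Suc k i R t)
  note prems = Suc.prems
  have i: "i < length (L u)" using Suc.hyps(2) by linarith
  have H0: "H (cell n u 0) = length (L u)" and len: "length (L u) \<le> n"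
    and Hi: "H (cell n u (Suc i)) = L u ! i"
    using prems(5,6) i by (auto simp: rows_def)
  have mods: "Suc (length (L u)) mod 2 ^ w = Suc (length (L u))" "cell n u (Suc i) mod 2 ^ w = cell n u (Suc i)"
     "Suc (Suc i) mod 2 ^ w = Suc (Suc i)"
    using small_less_word[of "Suc (length (L u))"] small_less_word[of "Suc (Suc i)"]
      cell_less_word[of u "Suc i"] prems(5) len i by simp_all
  have test: "expr_value w (R, H) (search_test s) = of_bool (L u ! i \<noteq> v)"
    using prems(1-4) i H0 Hi word_pos by (simp add: search_test_def mods cell_0_add Suc_cell)
  show ?case
  proof (rule wp_WhileI)
    assume "expr_value w (R, H) (search_test s) = 0"
    hence "L u ! i = v" using test by simp
    moreover have "R(8 := Suc i) = R" using prems(2) by auto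
    ultimately show "Q (R, H) (t + (1 + expr_time (search_test s)))"
      using prems(9)[of i "t + 16"] prems(7,8) by (simp add: search_time)
  next
    assume "expr_value w (R, H) (search_test s) \<noteq> 0"
    hence "L u ! i \<noteq> v" using test by simp
    have "wp w (While (search_test s) (Assign 8 (Op Plus (Reg 8) (Const 1)))) Q (R(8 := Suc (Suc i)), H) (t + 20)"
    proof (rule Suc.hyps(1)[where i = "Suc i"])
      show "k = length (L u) - Suc i" using Suc.hyps(2) by simp
      show "L u ! j \<noteq> v" if "j < Suc i" for j
        using that prems(8) \<open>L u ! i \<noteq> v\<close> by (cases "j = i") auto
      fix i' t'
      assume *: "i' \<le> length (L u)" "\<And>j. j < i' \<Longrightarrow> L u ! j \<noteq> v" "i' < length (L u) \<Longrightarrow> L u ! i' = v"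
        "t' \<le> t + 20 + 16 + 20 * (length (L u) - Suc i)"
      have "Q (R(8 := Suc i'), H) t'" by (rule prems(9)) (use * i in auto)
      thus "Q (R(8 := Suc (Suc i), 8 := Suc i'), H) t'" by simp
    qed (use prems i in simp_all)
    thus "wp w (Assign 8 (Op Plus (Reg 8) (Const 1)))
        (wp w (While (search_test s) (Assign 8 (Op Plus (Reg 8) (Const 1)))) Q)
        (R, H) (t + (1 + expr_time (search_test s)))"
      using prems(2) word_pos by (simp add: wp_Assign search_time mods add.assoc flip: Suc_eq_plus1 del: One_nat_def add_2_eq_Suc add_2_eq_Suc')
  qed
qed

text \<open>Includes the case that \<open>v\<close> does not occur, which arises in one of the two
  calls of every deletion.\<close>

lemma wp_remove:
  assumes R: "R 0 = n" "R r = u" "R s = v" and regs: "r \<notin> {7, 8}" "s \<notin> {7, 8}"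
    and u: "u < n" and H: "rows n H L" "distinct (L u)"
    and post: "\<And>R' H' ys t'. (\<And>i. i \<notin> {7, 8} \<Longrightarrow> R' i = R i) \<Longrightarrow> rows n H' (L(u := ys)) \<Longrightarrow>
      distinct ys \<Longrightarrow> set ys = set (L u) - {v} \<Longrightarrow> length ys \<le> length (L u) \<Longrightarrow>
      t' \<le> t + 50 + 20 * length (L u) \<Longrightarrow> Q (R', H') t'"
  shows "wp w (remove_code r s) Q (R, H) t"
proof -
  define R1 where "R1 = R(7 := cell n u 0, 8 := 1)"
  let ?found = "Cond (Op Less (Reg 8) (Op Plus (Heap (Reg 7)) (Const 1)))
       (Seq (Store (Op Plus (Reg 7) (Reg 8)) (Heap (Op Plus (Reg 7) (Heap (Reg 7)))))
            (Store (Reg 7) (Op Minus (Heap (Reg 7)) (Const 1))))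
       Skip"
  have H0: "H (cell n u 0) = length (L u)" and len: "length (L u) \<le> n"
    and nth: "\<And>i. i < length (L u) \<Longrightarrow> H (cell n u (Suc i)) = L u ! i"
    using H(1) u by (auto simp: rows_def)
  have mods: "Suc (length (L u)) mod 2 ^ w = Suc (length (L u))"
      "(length (L u) + 1) mod 2 ^ w = Suc (length (L u))"
    using small_less_word[of "Suc (length (L u))"] len by simp_all
  have "wp w (While (search_test s) (Assign 8 (Op Plus (Reg 8) (Const 1)))) (wp w ?found Q) (R1, H) (t + 8)"
  proof (rule wp_search[where u = u and i = 0 and v = v and L = L])
    fix i t'
    assume i: "i \<le> length (L u)" "\<And>j. j < i \<Longrightarrow> L u ! j \<noteq> v" "i < length (L u) \<Longrightarrow> L u ! i = v"
      and t': "t' \<le> t + 8 + 16 + 20 * (length (L u) - 0)"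
    show "wp w ?found Q (R1(8 := Suc i), H) t'"
    proof (cases "i < length (L u)")
      case False
      hence "v \<notin> set (L u)" using i(1,2) by (metis in_set_conv_nth le_antisym not_less)
      hence "Q (R1(8 := Suc i), H) (t' + 8)"
        using t' H by (intro post[where ys = "L u"]) (auto simp: R1_def)
      thus ?thesis using False i(1) word_pos
        by (simp add: wp_Cond wp_Skip R1_def H0 mods add.assoc del: One_nat_def add_2_eq_Suc add_2_eq_Suc')
    next
      case True
      define H1 where "H1 = H(cell n u (Suc i) := last (L u))"
      define L1 where "L1 = L(u := (L u)[i := last (L u)])"
      have ne: "L u \<noteq> []" using True by auto
      have rows1: "rows n H1 L1" unfolding H1_def L1_def by (rule rows_replace[OF H(1) u True])
      have "rows n (H1(cell n u 0 := length (L1 u) - 1)) (L1(u := butlast (L1 u)))"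
        by (rule rows_butlast[OF rows1 u])
      hence rows2: "rows n (H1(cell n u 0 := length (L u) - 1)) (L(u := butlast ((L u)[i := last (L u)])))"
        by (simp add: L1_def)
      have H1: "H1 (cell n u 0) = length (L u)" using rows1 u by (simp add: rows_def L1_def)
      have Hlast: "H (cell n u (length (L u))) = last (L u)"
        using nth[of "length (L u) - 1"] ne by (simp add: last_conv_nth)
      have ar: "cell n u (length (L u)) mod 2 ^ w = cell n u (length (L u))"
          "cell n u (Suc i) mod 2 ^ w = cell n u (Suc i)"
          "(2 ^ w + length (L u) - 1) mod 2 ^ w = length (L u) - 1"
      proof -
        show "cell n u (length (L u)) mod 2 ^ w = cell n u (length (L u))"
          using cell_less_word[of u "length (L u)"] u len by simp
        show "cell n u (Suc i) mod 2 ^ w = cell n u (Suc i)"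
          using cell_less_word[of u "Suc i"] u len True by simp
        have "2 ^ w + length (L u) - 1 = length (L u) - 1 + 2 ^ w" using ne by (cases "L u") auto
        moreover have "length (L u) - 1 < 2 ^ w" using small_less_word[of "length (L u) - 1"] len by simp
        ultimately show "(2 ^ w + length (L u) - 1) mod 2 ^ w = length (L u) - 1"
          by (simp only: mod_add_self2 mod_less)
      qed
      have "Q (R1(8 := Suc i), H1(cell n u 0 := length (L u) - 1)) (t' + 22)"
        using t' H(2) True i(3) swap_delete[of "L u" i v] rows2
        by (intro post[where ys = "butlast ((L u)[i := last (L u)])"]) (auto simp: R1_def)
      moreover have "R1 7 = cell n u 0" by (simp add: R1_def)
      ultimately show ?thesis using True word_pos
        by (simp add: wp_Cond wp_Seq wp_Store H0 Hlast H1 mods cell_0_add Suc_cell ar add.assoc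
            flip: H1_def del: One_nat_def add_2_eq_Suc add_2_eq_Suc')
    qed
  qed (use R regs u H in \<open>auto simp: R1_def\<close>)
  thus ?thesis
    unfolding remove_code_def R1_def using R(1) u base_value[of R r u H, OF R(1,2)] word_pos
    by (simp add: wp_Seq wp_Assign base_time add.assoc del: One_nat_def add_2_eq_Suc add_2_eq_Suc')
qed

end

section \<open>Correctness and cost of the updates\<close>

lemma orientation_insert:
  assumes D: "orientation E D" and e: "{u, v} \<notin> E" "u \<noteq> v"
  shows "orientation (insert {u, v} E) (insert (u, v) D)"
proof -
  have sub: "\<And>p q. (p, q) \<in> D \<Longrightarrow> {p, q} \<in> E"
    and iff: "\<And>p q. {p, q} \<in> E \<Longrightarrow> (p, q) \<in> D \<longleftrightarrow> (q, p) \<notin> D"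
    using D unfolding orientation_def by auto
  have new: "(u, v) \<notin> D" "(v, u) \<notin> D" using sub[of u v] sub[of v u] e(1) by (auto simp: insert_commute)
  have "(p, q) \<in> insert (u, v) D \<longleftrightarrow> (q, p) \<notin> insert (u, v) D" if "{p, q} \<in> insert {u, v} E" for p q
  proof (cases "{p, q} = {u, v}")
    case True
    thus ?thesis using new e(2) by (auto simp: doubleton_eq_iff)
  next
    case False
    hence "{p, q} \<in> E" "(p, q) \<noteq> (u, v)" "(q, p) \<noteq> (u, v)" using that by (auto simp: doubleton_eq_iff)
    thus ?thesis using iff[of p q] by auto
  qed
  thus ?thesis using sub unfolding orientation_def by blast
qed

lemma orientation_delete:
  assumes "orientation E D"
  shows "orientation (E - {{u, v}}) (D - {(u, v), (v, u)})"
  using assms unfolding orientation_def by (auto simp: doubleton_eq_iff)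

text \<open>The stack is absent: a cascade ends with no overfull vertex, so between updates the
  stack is empty.\<close>

definition maintained :: "nat \<Rightarrow> nat \<Rightarrow> graph \<Rightarrow> memory \<Rightarrow> (nat \<Rightarrow> nat list) \<Rightarrow> bool" where
  "maintained n a E H L \<longleftrightarrow> rows n H L \<and> adjacency n L \<and> orientation E (digraph n L) \<and>
     acyclic (digraph n L) \<and> (\<forall>z < n. length (L z) \<le> 2 * a + 1)"

context word_size
begin

text \<open>\<open>X\<close> is the reference after the insertion. The preliminary reset and the new
  edge raise the disagreement by \<open>O(a)\<close>, each unit worth \<open>overhead a\<close>,
  which gives the quadratic cost.\<close>

lemma exec_insert:
  assumes a: "1 \<le> a" and E: "simple_graph n (insert {u, v} E)" "{u, v} \<notin> E"
    and X: "half_orientation n (2 * a + 1) (insert {u, v} E) X" and L: "maintained n a E H L"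
  shows "\<exists>t R' H' L'. exec w (insert_code orientation_algorithm) (initial_registers n a u v, H) t (R', H') \<and>
    maintained n a (insert {u, v} E) H' L' \<and>
    t + overhead a * disagreement X (digraph n L') \<le> overhead a * disagreement X (digraph n L) + 3000 * a\<^sup>2"
proof -
  let ?E = "insert {u, v} E"
  define R where "R = initial_registers n a u v"
  define Q where "Q s t \<longleftrightarrow> (\<exists>L'. maintained n a ?E (snd s) L' \<and>
    t + overhead a * disagreement X (digraph n L') \<le> overhead a * disagreement X (digraph n L) + 3000 * a\<^sup>2)"
    for s :: state and t :: nat
  have uv: "u \<noteq> v" "u < n" "v < n" using simple_graph_edgeD[OF E(1), of u v] by auto
  have simple: "simple_graph n E" using E(1) by (auto simp: simple_graph_def)
  have Xt: "X (p, q) + X (q, p) = 2" if "{p, q} \<in> ?E" for p q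
    using X that unfolding half_orientation_def by metis
  have Xo: "out_weight n X p \<le> 2 * a + 1" if "p < n" for p
    using X that unfolding half_orientation_def by metis
  have H: "rows n H L" "adjacency n L" "orientation E (digraph n L)" "acyclic (digraph n L)"
    and deg: "\<And>z. z < n \<Longrightarrow> length (L z) \<le> 2 * a + 1"
    using L unfolding maintained_def by auto
  have R: "R 0 = n" "R 1 = a" "R 2 = u" "R 3 = v" "R 4 = 0"
    by (simp_all add: R_def initial_registers_def)
  have "wp w reset_code (wp w (append_code 2 3) (wp w (While (Reg 4) cascade_step) Q)) (R(5 := v), H) (0 + 2)"
  proof (rule wp_reset[where x = v and L = L])
    show "stack n a ((R(5 := v)) 4) H L v" using R(5) stack_empty[OF deg] by simp
    fix R1 H1 L1 t1
    assume R1: "\<And>i. i < 4 \<Longrightarrow> R1 i = (R(5 := v)) i"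
      and L1: "rows n H1 L1" "adjacency n L1" "L1 v = []" "digraph n L1 = reset v (digraph n L)"
        "stack n a (R1 4) H1 L1 v"
      and t1: "t1 \<le> 0 + 2 + 9 + 60 * length (L v)"
    let ?L2 = "L1(u := L1 u @ [v])"
    have D1: "orientation E (digraph n L1)" "acyclic (digraph n L1)"
      unfolding L1(4) using H by (auto intro: orientation_reset acyclic_reset)
    have new: "v \<notin> set (L1 u)" "u \<notin> set (L1 v)"
    proof -
      have "(u, v) \<notin> digraph n L1" using D1(1) E(2) unfolding orientation_def by blast
      thus "v \<notin> set (L1 u)" using uv by (simp add: digraph_def)
    qed (simp add: L1(3))
    have D2: "digraph n ?L2 = insert (u, v) (digraph n L1)"
      using uv by (auto simp: digraph_def split: if_splits)
    have "(v, u) \<notin> digraph n L1" using new(2) by (simp add: digraph_def)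
    hence "q < n \<and> p \<noteq> q \<and> (q, p) \<notin> digraph n ?L2" if "(p, q) \<in> digraph n ?L2" for p q
      using that L1(2) uv unfolding D2 adjacency_iff by blast
    moreover have "distinct (?L2 p)" if "p < n" for p
      using that L1(2) new(1) by (simp add: adjacency_iff)
    ultimately have adj2: "adjacency n ?L2" unfolding adjacency_iff by blast
    have orient2: "orientation ?E (digraph n ?L2)"
      unfolding D2 by (rule orientation_insert[OF D1(1) E(2) uv(1)])
    have "acyclic (digraph n L1 \<union> {(u, v)})"
      by (rule acyclic_Un_sink[OF D1(2), of v]) (use uv L1(3) in \<open>auto simp: digraph_def\<close>)
    hence acyclic2: "acyclic (digraph n ?L2)" unfolding D2 by simp
    \<comment> \<open>The new edge adds at most 2 and the preceding reset at most
      \<open>2 * (2 * a + 1)\<close>, together \<open>4 * a + 4\<close>.\<close>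
    have "disagreement X (digraph n ?L2) \<le> disagreement X (digraph n L1) + X (v, u)"
    proof -
      have "finite ((digraph n L1)\<inverse>)" using finite_digraph by simp
      moreover have "(digraph n ?L2)\<inverse> = insert (v, u) ((digraph n L1)\<inverse>)" unfolding D2 by auto
      ultimately show ?thesis unfolding disagreement_def by (simp add: sum.insert_if)
    qed
    moreover have "X (v, u) \<le> 2" using Xt[of u v] by simp
    moreover have "disagreement X (digraph n L1) + 2 * length (L v) \<le> disagreement X (digraph n L) + 2 * (2 * a + 1)"
      using disagreement_reset[OF finite_digraph H(3) simple uv(3) Xt Xo[OF uv(3)]]
      unfolding L1(4) outdegree_digraph[OF H(2) uv(3)] by simp
    ultimately have pot: "disagreement X (digraph n ?L2) \<le> disagreement X (digraph n L) + (4 * a + 4)"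
      by simp
    have t1': "t1 \<le> 71 + 120 * a" using t1 deg[OF uv(3)] by simp
    show "wp w (append_code 2 3) (wp w (While (Reg 4) cascade_step) Q) (R1, H1) t1"
    proof (rule wp_append[where y = u and v = v and x = v and L = L1])
      show "length (L1 u) < n"
        using adjacency_length_less[OF L1(2) uv(2,3) new(1)] uv by simp
      fix R2 H2 t2
      assume R2: "\<And>i. i \<noteq> 4 \<Longrightarrow> i \<noteq> 8 \<Longrightarrow> R2 i = R1 i"
        and L2: "rows n H2 ?L2" "stack n a (R2 4) H2 ?L2 v" and t2: "t2 \<le> t1 + 40"
      show "wp w (While (Reg 4) cascade_step) Q (R2, H2) t2"
      proof (rule wp_cascade[where E = ?E and X = X and L = ?L2])
        show "stack n a (R2 4) H2 ?L2 n"
          by (rule stack_exempt[OF L2(2)]) (use uv L1(3) in simp)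
        fix R3 H3 L3 t3
        assume L3: "rows n H3 L3" "adjacency n L3" "orientation ?E (digraph n L3)"
            "acyclic (digraph n L3)" "\<And>z. z < n \<Longrightarrow> length (L3 z) \<le> 2 * a + 1"
          and t3: "t3 + overhead a * disagreement X (digraph n L3) \<le>
            t2 + 2 + overhead a * disagreement X (digraph n ?L2)"
        have "maintained n a ?E H3 L3" using L3 unfolding maintained_def by blast
        moreover have "t3 + overhead a * disagreement X (digraph n L3) \<le>
            overhead a * disagreement X (digraph n L) + 3000 * a\<^sup>2"
        proof -
          have "overhead a * disagreement X (digraph n ?L2) \<le>
              overhead a * (disagreement X (digraph n L) + (4 * a + 4))"
            using pot by (rule mult_le_mono2)
          also have "\<dots> = overhead a * disagreement X (digraph n L) + overhead a * (4 * a + 4)"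
            by (rule distrib_left)
          finally have "t3 + overhead a * disagreement X (digraph n L3) \<le>
              overhead a * disagreement X (digraph n L) + overhead a * (4 * a + 4) + (113 + 120 * a)"
            using t3 t2 t1' by linarith
          moreover have "overhead a * (4 * a + 4) + (113 + 120 * a) \<le> 3000 * a\<^sup>2"
          proof -
            \<comment> \<open>As \<open>1 <= a\<close>, the total is at most
              \<open>(480 + 1320 + 833) * a^2\<close>, below the rounded constant 3000.\<close>
            have "overhead a * (4 * a + 4) + (113 + 120 * a) = 480 * a\<^sup>2 + 1320 * a + 833"
              by (simp add: overhead_def algebra_simps power2_eq_square)
            moreover have "1 \<le> a\<^sup>2" "a \<le> a\<^sup>2" using a by (simp_all add: power2_eq_square)
            ultimately show ?thesis by linarith
          qed
          ultimately show ?thesis by linarith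
        qed
        ultimately show "Q (R3, H3) t3" unfolding Q_def by auto
      qed (use E Xt Xo R R1 R2 L2 adj2 orient2 acyclic2 in auto)
    qed (use R R1 uv L1 in auto)
  qed (use R uv H in auto)
  hence "wp w (insert_code orientation_algorithm) Q (R, H) 0"
    unfolding orientation_algorithm_def using R by (simp add: wp_Seq wp_Assign numeral_2_eq_2)
  thus ?thesis unfolding wp_def Q_def R_def by auto
qed

text \<open>Removing an edge creates neither a cycle nor an overfull vertex, so no cascade follows.
  The time is spent on searching two lists of at most \<open>2 * a + 1\<close> entries.\<close>

lemma exec_delete:
  assumes E: "simple_graph n E" "{u, v} \<in> E" and L: "maintained n a E H L"
  shows "\<exists>t R' H' L'. exec w (delete_code orientation_algorithm) (initial_registers n a u v, H) t (R', H') \<and>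
    maintained n a (E - {{u, v}}) H' L' \<and> digraph n L' \<subseteq> digraph n L \<and> t \<le> 140 + 80 * a"
proof -
  define R where "R = initial_registers n a u v"
  define Q where "Q s t \<longleftrightarrow> (\<exists>L'. maintained n a (E - {{u, v}}) (snd s) L' \<and>
    digraph n L' \<subseteq> digraph n L \<and> t \<le> 140 + 80 * a)" for s :: state and t :: nat
  have uv: "u \<noteq> v" "u < n" "v < n" using simple_graph_edgeD[OF E] by auto
  have H: "rows n H L" "adjacency n L" "orientation E (digraph n L)" "acyclic (digraph n L)"
    and deg: "\<And>z. z < n \<Longrightarrow> length (L z) \<le> 2 * a + 1"
    using L unfolding maintained_def by auto
  have dist: "\<And>z. z < n \<Longrightarrow> distinct (L z)" using H(2) by (simp add: adjacency_def)
  have R: "R 0 = n" "R 2 = u" "R 3 = v"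
    by (simp_all add: R_def initial_registers_def)
  have "wp w (remove_code 2 3) (wp w (remove_code 3 2) Q) (R, H) 0"
  proof (rule wp_remove[where u = u and v = v and L = L])
    fix R1 H1 ys t1
    assume R1: "\<And>i. i \<notin> {7, 8} \<Longrightarrow> R1 i = R i" and L1: "rows n H1 (L(u := ys))"
      and ys: "distinct ys" "set ys = set (L u) - {v}" "length ys \<le> length (L u)"
      and t1: "t1 \<le> 0 + 50 + 20 * length (L u)"
    show "wp w (remove_code 3 2) Q (R1, H1) t1"
    proof (rule wp_remove[where u = v and v = u and L = "L(u := ys)"])
      fix R2 H2 zs t2
      let ?L = "L(u := ys, v := zs)"
      assume L2: "rows n H2 ?L" and zs: "distinct zs" "set zs = set ((L(u := ys)) v) - {u}"
        "length zs \<le> length ((L(u := ys)) v)" and t2: "t2 \<le> t1 + 50 + 20 * length ((L(u := ys)) v)"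
      have D: "digraph n ?L = digraph n L - {(u, v), (v, u)}"
      proof -
        have "set zs = set (L v) - {u}" using zs(2) uv(1) by simp
        hence "(p, q) \<in> digraph n ?L \<longleftrightarrow> (p, q) \<in> digraph n L \<and> (p, q) \<noteq> (u, v) \<and> (p, q) \<noteq> (v, u)" for p q
          using uv(1) ys(2) by (cases "p = u"; cases "p = v") (simp_all add: digraph_def)
        thus ?thesis by auto
      qed
      have "distinct (?L p)" if "p < n" for p using dist[OF that] ys(1) zs(1) by simp
      moreover have "q < n \<and> p \<noteq> q \<and> (q, p) \<notin> digraph n ?L" if "(p, q) \<in> digraph n ?L" for p q
        using that H(2) unfolding D adjacency_iff by blast
      ultimately have "adjacency n ?L" unfolding adjacency_iff by blast
      moreover have "orientation (E - {{u, v}}) (digraph n ?L)"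
        unfolding D by (rule orientation_delete[OF H(3)])
      moreover have "acyclic (digraph n ?L)" unfolding D by (rule acyclic_subset[OF H(4)]) auto
      moreover have "\<forall>z<n. length (?L z) \<le> 2 * a + 1"
      proof (intro allI impI)
        fix z assume "z < n"
        from deg[OF this] show "length (?L z) \<le> 2 * a + 1"
          using ys(3) zs(3) uv(1) by (cases "z = v"; cases "z = u") simp_all
      qed
      ultimately have "maintained n a (E - {{u, v}}) H2 ?L" using L2 unfolding maintained_def by blast
      moreover have "t2 \<le> 140 + 80 * a" using t1 t2 uv(1) deg[OF uv(2)] deg[OF uv(3)] by simp
      ultimately show "Q (R2, H2) t2" unfolding Q_def D by (intro exI[of _ ?L]) (auto simp: D)
    qed (use R R1 uv L1 dist in auto)
  qed (use R uv H dist in auto)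
  hence "wp w (delete_code orientation_algorithm) Q (R, H) 0"
    unfolding orientation_algorithm_def by (simp add: wp_Seq)
  thus ?thesis unfolding wp_def Q_def R_def by auto
qed

text \<open>The potential is \<open>overhead a\<close> times the disagreement with the current
  reference. It starts at 0, and the bounds for single updates telescope.\<close>

lemma run_maintained:
  assumes a: "1 \<le> a" and legal: "legal_sequence n us"
    and X: "\<And>i. i \<le> length us \<Longrightarrow> half_orientation n (2 * a + 1) (graph_after (take i us)) (X i)"
    and step: "\<And>i F. i < length us \<Longrightarrow> finite F \<Longrightarrow> \<forall>(u, v) \<in> F. {u, v} \<in> graph_after (take i us) \<Longrightarrow>
      sum (X (Suc i)) F \<le> sum (X i) F + (if is_insertion (us ! i) then 0 else 2 * l)"
    and "i \<le> length us"
  shows "\<exists>t H L. run orientation_algorithm w n a (take i us) t H \<and>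
    maintained n a (graph_after (take i us)) H L \<and>
    t + overhead a * disagreement (X i) (digraph n L) \<le> 3000 * a\<^sup>2 * insertions (take i us) +
      (140 + 80 * a + overhead a * (2 * l)) * deletions (take i us)"
  using \<open>i \<le> length us\<close>
proof (induction i)
  case 0
  have "maintained n a {} (\<lambda>_. 0) (\<lambda>_. [])"
    by (auto simp: maintained_def rows_def adjacency_def digraph_def orientation_def acyclic_def)
  moreover have "disagreement (X 0) (digraph n (\<lambda>_. [])) = 0"
    by (simp add: disagreement_def digraph_def)
  ultimately show ?case
    using run.start[of orientation_algorithm w n a]
    by (intro exI[of _ 0] exI[of _ "\<lambda>_. 0"] exI[of _ "\<lambda>_. []"]) (simp add: graph_after_def)
next
  case (Suc i)
  let ?E = "graph_after (take i us)" and ?E' = "graph_after (take (Suc i) us)"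
  have i: "i < length us" using Suc.prems by simp
  obtain t H L where IH: "run orientation_algorithm w n a (take i us) t H" "maintained n a ?E H L"
    "t + overhead a * disagreement (X i) (digraph n L) \<le> 3000 * a\<^sup>2 * insertions (take i us) +
      (140 + 80 * a + overhead a * (2 * l)) * deletions (take i us)"
    using Suc.IH Suc.prems by auto
  have upd: "legal_update n ?E (us ! i)" using legal i by (simp add: legal_sequence_def)
  have take: "take (Suc i) us = take i us @ [us ! i]" using i by (simp add: take_Suc_conv_app_nth)
  have E': "?E' = apply_update (us ! i) ?E" by (rule graph_after_take_Suc[OF i])
  have D: "\<forall>(p, q) \<in> (digraph n L)\<inverse>. {p, q} \<in> ?E"
  proof -
    have "{p, q} \<in> ?E" if "(q, p) \<in> digraph n L" for p q
      using IH(2) that unfolding maintained_def orientation_def by (metis insert_commute)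
    thus ?thesis by blast
  qed
  \<comment> \<open>The reference is exchanged first, against the old digraph, whose pairs are edges
    before the update as \<open>step\<close> demands; only then is the update executed.\<close>
  have change: "disagreement (X (Suc i)) (digraph n L) \<le> disagreement (X i) (digraph n L) +
      (if is_insertion (us ! i) then 0 else 2 * l)"
    unfolding disagreement_def by (rule step[OF i _ D]) (simp add: finite_digraph)
  show ?case
  proof (cases "us ! i")
    case (Insert u v)
    have E: "?E' = insert {u, v} ?E" "{u, v} \<notin> ?E" using E' upd Insert by auto
    have simple: "simple_graph n (insert {u, v} ?E)"
      using simple_graph_after[OF legal Suc.prems] E(1) by simp
    have X': "half_orientation n (2 * a + 1) (insert {u, v} ?E) (X (Suc i))"
      using X[OF Suc.prems] unfolding E(1) .
    obtain t' R' H' L' where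
      *: "exec w (insert_code orientation_algorithm) (initial_registers n a u v, H) t' (R', H')"
      "maintained n a (insert {u, v} ?E) H' L'"
      "t' + overhead a * disagreement (X (Suc i)) (digraph n L') \<le>
        overhead a * disagreement (X (Suc i)) (digraph n L) + 3000 * a\<^sup>2"
      using exec_insert[OF a simple E(2) X' IH(2)] by metis
    have "process orientation_algorithm w n a (us ! i) H t' H'" using *(1) Insert by auto
    from run.step[OF IH(1) this]
    have run': "run orientation_algorithm w n a (take (Suc i) us) (t + t') H'" by (simp only: take)
    have "overhead a * disagreement (X (Suc i)) (digraph n L) \<le>
        overhead a * disagreement (X i) (digraph n L)"
      using change Insert by (intro mult_le_mono2) simp
    moreover have "insertions (take (Suc i) us) = Suc (insertions (take i us))"
        "deletions (take (Suc i) us) = deletions (take i us)"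
      using Insert by (simp_all add: take insertions_def deletions_def)
    ultimately have "t + t' + overhead a * disagreement (X (Suc i)) (digraph n L') \<le>
        3000 * a\<^sup>2 * insertions (take (Suc i) us) +
        (140 + 80 * a + overhead a * (2 * l)) * deletions (take (Suc i) us)"
      using IH(3) *(3) by (simp only: mult_Suc_right)
    with run' *(2) show ?thesis unfolding E(1) by blast
  next
    case (Delete u v)
    have E: "?E' = ?E - {{u, v}}" "{u, v} \<in> ?E" using E' upd Delete by auto
    have simple: "simple_graph n ?E" using simple_graph_after[OF legal] i by simp
    obtain t' R' H' L' where
      *: "exec w (delete_code orientation_algorithm) (initial_registers n a u v, H) t' (R', H')"
      "maintained n a (?E - {{u, v}}) H' L'" "digraph n L' \<subseteq> digraph n L" "t' \<le> 140 + 80 * a"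
      using exec_delete[OF simple E(2) IH(2)] by metis
    have "process orientation_algorithm w n a (us ! i) H t' H'" using *(1) Delete by auto
    from run.step[OF IH(1) this]
    have run': "run orientation_algorithm w n a (take (Suc i) us) (t + t') H'" by (simp only: take)
    have "disagreement (X (Suc i)) (digraph n L') \<le> disagreement (X (Suc i)) (digraph n L)"
      unfolding disagreement_def using *(3) by (intro sum_mono2) (auto simp: finite_digraph)
    hence "overhead a * disagreement (X (Suc i)) (digraph n L') \<le>
        overhead a * (disagreement (X i) (digraph n L) + 2 * l)"
      using change Delete by (intro mult_le_mono2) simp
    moreover have "insertions (take (Suc i) us) = insertions (take i us)"
        "deletions (take (Suc i) us) = Suc (deletions (take i us))"
      using Delete by (simp_all add: take insertions_def deletions_def)
    ultimately have "t + t' + overhead a * disagreement (X (Suc i)) (digraph n L') \<le>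
        3000 * a\<^sup>2 * insertions (take (Suc i) us) +
        (140 + 80 * a + overhead a * (2 * l)) * deletions (take (Suc i) us)"
      using IH(3) *(4) by (simp only: mult_Suc_right distrib_left)
    with run' *(2) show ?thesis unfolding E(1) by blast
  qed
qed

end

section \<open>From the invariant to the stated bounds\<close>

lemma maintained_stores:
  assumes "maintained n a E H L"
  shows "stores_digraph n H (digraph n L)" "\<forall>v < n. outdegree (digraph n L) v \<le> 2 * a + 1"
proof -
  have L: "rows n H L" "adjacency n L" "\<forall>v < n. length (L v) \<le> 2 * a + 1"
    using assms by (simp_all add: maintained_def)
  thus "\<forall>v < n. outdegree (digraph n L) v \<le> 2 * a + 1"
    by (simp add: outdegree_def outdegree_digraph)
  have "distinct (L v)" if "v < n" for v using L(2) that by (simp add: adjacency_def)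
  thus "stores_digraph n H (digraph n L)"
    using L(1) by (simp add: stores_digraph_def rows_out_list digraph_Image)
qed

text \<open>Bernoulli's inequality \<open>(1 + 1 / k) ^ j >= 1 + j / k\<close>, multiplied by
  \<open>k ^ (j + 1)\<close>.\<close>

lemma bernoulli_nat: "k ^ j * (k + j) \<le> k * (k + 1) ^ j" for k j :: nat
proof (induction j)
  case (Suc j)
  have "k ^ Suc j * (k + Suc j) \<le> (k + 1) * (k ^ j * (k + j))" by (simp add: algebra_simps)
  also have "\<dots> \<le> (k + 1) * (k * (k + 1) ^ j)" by (rule mult_le_mono2[OF Suc.IH])
  also have "\<dots> = k * (k + 1) ^ Suc j" by (simp add: algebra_simps)
  finally show ?case .
qed simp

text \<open>By Bernoulli's inequality \<open>2 * a\<close> growth steps at least double the size, so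
  \<open>m\<close> such blocks exceed \<open>n\<close>. This fixes the path length
  \<open>l = 2 * a * m\<close>.\<close>

lemma distance_bound:
  assumes "1 \<le> a" "n < 2 ^ m"
  shows "n * (2 * a) ^ (2 * a * m) < (2 * a + 1) ^ (2 * a * m)"
proof -
  define k where "k = 2 * a"
  have "k * (2 * k ^ k) \<le> k * (k + 1) ^ k"
  proof -
    have "k * (2 * k ^ k) = k ^ k * (k + k)" by (simp add: algebra_simps)
    thus ?thesis using bernoulli_nat[of k k] by (simp only:)
  qed
  moreover have "0 < k" using assms(1) by (simp add: k_def)
  ultimately have "2 * k ^ k \<le> (k + 1) ^ k" unfolding mult_le_cancel1 by blast
  hence "(2 * k ^ k) ^ m \<le> ((k + 1) ^ k) ^ m" by (rule power_mono) simp
  hence "2 ^ m * k ^ (k * m) \<le> (k + 1) ^ (k * m)"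
    by (simp add: power_mult power_mult_distrib)
  moreover have "n * k ^ (k * m) < 2 ^ m * k ^ (k * m)" using assms by (simp add: k_def)
  ultimately show ?thesis unfolding k_def by linarith
qed

text \<open>The linear part is at most \<open>220 * a^2 * m\<close>, the rerouting part at most
  \<open>(480 + 720) * a^2 * m\<close>.\<close>

lemma deletion_cost:
  assumes "1 \<le> a" "1 \<le> m"
  shows "140 + 80 * a + overhead a * (2 * (2 * a * m)) \<le> 1500 * a\<^sup>2 * m"
proof -
  have "a \<le> a\<^sup>2" using assms(1) by (simp add: power2_eq_square)
  hence "a * m \<le> a\<^sup>2 * m" "a * 1 \<le> a\<^sup>2 * m" using assms(2) by (intro mult_le_mono; simp)+
  moreover have "140 + 80 * a + overhead a * (2 * (2 * a * m)) = 140 + 80 * a + 480 * (a\<^sup>2 * m) + 720 * (a * m)"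
    by (simp add: overhead_def algebra_simps power2_eq_square)
  ultimately show ?thesis using assms(1) by linarith
qed

text \<open>The first update of a legal sequence is an insertion with distinct endpoints. Hence
  \<open>log 2 n >= 1\<close>, and the logarithmic charge absorbs additive constants.\<close>

lemma two_vertices: "legal_sequence n us \<Longrightarrow> us \<noteq> [] \<Longrightarrow> 2 \<le> n"
  unfolding legal_sequence_def
  by (cases "us ! 0") (force simp: graph_after_def)+

text \<open>The factor 2 absorbs the rounding, since \<open>log 2 n >= 1\<close>.\<close>

lemma log_bound:
  assumes "2 \<le> n"
  obtains m where "1 \<le> m" "n < 2 ^ m" "real m \<le> 2 * log 2 (real n)"
proof -
  define m where "m = Suc (nat \<lfloor>log 2 (real n)\<rfloor>)"
  have log1: "1 \<le> log 2 (real n)" using assms by (simp add: le_log_iff)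
  hence m: "log 2 (real n) < real m" "real m \<le> log 2 (real n) + 1"
    unfolding m_def by linarith+
  have "real n < 2 powr real m" using m(1) assms by (simp add: log_less_iff)
  hence "n < 2 ^ m" by (simp add: powr_realpow)
  moreover have "1 \<le> m" by (simp add: m_def)
  ultimately show ?thesis using that m(2) log1 by simp
qed

lemma orientation_algorithm_correct:
  assumes a: "1 \<le> a" and word: "(n + a + 2) ^ 2 \<le> 2 ^ w"
    and legal: "legal_sequence n us" and arb: "arboricity_bounded a us"
  shows "maintains_orientation orientation_algorithm w n a (2 * a + 1) us \<and>
    amortized_cost orientation_algorithm w n a (3000 * real a ^ 2) (3000 * (real a ^ 2 * log 2 (real n))) us"
proof -
  interpret word_size n a w by unfold_locales (rule word)
  obtain m where m: "1 \<le> m" "n < 2 ^ m" "us \<noteq> [] \<Longrightarrow> real m \<le> 2 * log 2 (real n)"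
  proof (cases "us = []")
    case True
    \<comment> \<open>Without updates there is no deletion to charge, so any \<open>m\<close> with
      \<open>n < 2 ^ m\<close> will do.\<close>
    have "n < 2 ^ Suc n" by (rule less_trans[OF less_exp]) simp
    thus ?thesis using that[of "Suc n"] True by simp
  next
    case False
    thus ?thesis using log_bound[OF two_vertices[OF legal]] that by metis
  qed
  \<comment> \<open>The references depend on the whole sequence; they are chosen once and then serve
    all its prefixes.\<close>
  obtain X where X: "\<And>i. i \<le> length us \<Longrightarrow> half_orientation n (2 * a + 1) (graph_after (take i us)) (X i)"
    "\<And>i F. i < length us \<Longrightarrow> finite F \<Longrightarrow> \<forall>(u, v) \<in> F. {u, v} \<in> graph_after (take i us) \<Longrightarrow>
      sum (X (Suc i)) F \<le> sum (X i) F + (if is_insertion (us ! i) then 0 else 2 * (2 * a * m))"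
    using half_orientation_sequence[OF legal arb distance_bound[OF a m(2)]]
    by (metis less_imp_le)
  have main: "\<exists>t H D. run orientation_algorithm w n a (take i us) t H \<and> stores_digraph n H D \<and>
      orientation (graph_after (take i us)) D \<and> acyclic D \<and> (\<forall>v < n. outdegree D v \<le> 2 * a + 1) \<and>
      real t \<le> 3000 * real a ^ 2 * real (insertions (take i us)) +
        3000 * (real a ^ 2 * log 2 (real n)) * real (deletions (take i us))"
    if i: "i \<le> length us" for i
  proof -
    let ?ins = "insertions (take i us)" and ?del = "deletions (take i us)"
    obtain t H L where *: "run orientation_algorithm w n a (take i us) t H"
      "maintained n a (graph_after (take i us)) H L"
      "t + overhead a * disagreement (X i) (digraph n L) \<le> 3000 * a\<^sup>2 * ?ins +
        (140 + 80 * a + overhead a * (2 * (2 * a * m))) * ?del"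
      using run_maintained[OF a legal X i] by blast
    have "t \<le> 3000 * a\<^sup>2 * ?ins + 1500 * a\<^sup>2 * m * ?del"
      using *(3) mult_le_mono1[OF deletion_cost[OF a m(1)], of ?del] by linarith
    hence "real t \<le> real (3000 * a\<^sup>2 * ?ins + 1500 * a\<^sup>2 * m * ?del)" by (rule of_nat_mono)
    also have "\<dots> = 3000 * real a ^ 2 * real ?ins + 1500 * real a ^ 2 * (real m * real ?del)" by simp
    finally have "real t \<le> 3000 * real a ^ 2 * real ?ins + 1500 * real a ^ 2 * (real m * real ?del)" .
    moreover have "real m * real ?del \<le> 2 * log 2 (real n) * real ?del"
    proof (cases "us = []")
      case True
      thus ?thesis by (simp add: deletions_def)
    next
      case False
      thus ?thesis using m(3) by (intro mult_right_mono) auto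
    qed
    hence "1500 * real a ^ 2 * (real m * real ?del) \<le> 1500 * real a ^ 2 * (2 * log 2 (real n) * real ?del)"
      by (rule mult_left_mono) simp
    ultimately have "real t \<le> 3000 * real a ^ 2 * real ?ins +
        3000 * (real a ^ 2 * log 2 (real n)) * real ?del"
      by (simp add: algebra_simps)
    thus ?thesis
      using *(1,2) maintained_stores[OF *(2)] unfolding maintained_def by blast
  qed
  show ?thesis
    unfolding maintains_orientation_def amortized_cost_def using main by blast
qed

text \<open>The witnesses are \<open>orientation_algorithm\<close>, \<open>C = 3000\<close> and
  \<open>c = 2\<close>, uniform in the number of vertices, the arboricity bound, the word size and
  the update sequence.\<close>

theorem theorem5:
  "\<exists>(A :: algorithm) (C :: real) (c :: nat).
     \<forall>(n :: nat) (\<alpha>max :: nat) (w :: nat) (us :: update list).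
       1 \<le> \<alpha>max \<and> (n + \<alpha>max + 2) ^ c \<le> 2 ^ w \<and>
       legal_sequence n us \<and> arboricity_bounded \<alpha>max us \<longrightarrow>
       maintains_orientation A w n \<alpha>max (2 * \<alpha>max + 1) us \<and>
       amortized_cost A w n \<alpha>max (C * real \<alpha>max ^ 2) (C * (real \<alpha>max ^ 2 * log 2 (real n))) us"
  using orientation_algorithm_correct by blast

end
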